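(* Let $V=(V_1,\ldots,V_k)$ and $V'=(V_1',\ldots,V_k')$ be $k$-tuples of doubly $\Lambda$-commuting row isometries acting on Hilbert spaces $\mathcal K$ and $\mathcal K'$, respectively. Then $V$ is unitarily equivalent to $V'$ if and only if, for every $A\subset\{1,\ldots,k\}$, the $A$-wandering data of $V$ is unitarily equivalent to the $A$-wandering data of $V'$.
   Context: Fix integers $k\ge1$, $n_1,\ldots,n_k\ge 1$ and, for $i\ne j$ in $\{1,\ldots,k\}$, an $n_i\times n_j$ matrix $\Lambda_{i,j}=[\lambda_{i,j}(s,t)]$ with entries in $\mathbb T=\{z\in\mathbb C:|z|=1\}$, such that $\lambda_{j,i}(t,s)=\overline{\lambda_{i,j}(s,t)}$. A row isometry $V_i=[V_{i,1}\cdots V_{i,n_i}]$ on $\mathcal K$ consists of $V_{i,s}\in B(\mathcal K)$ with $V_{i,s}^*V_{i,t}=\delta_{st}I$. Row isometries $V_1,\ldots,V_k$ are doubly $\Lambda$-commuting if $V_{i,s}^*V_{j,t}=\overline{\lambda_{i,j}(s,t)}\,V_{j,t}V_{i,s}^*$ for all $i\neq j$ and all $s,t$. $\mathbb F_{n_i}^+$ is the unital free semigroup with generators $g_1^i,\ldots,g_{n_i}^i$ and neutral element $g_0^i$; $V_{i,\alpha}:=V_{i,p_1}\cdots V_{i,p_m}$ for $\alpha=g^i_{p_1}\cdots g^i_{p_m}$, $V_{i,g_0^i}:=I$. $k$-tuples $V$ on $\mathcal K$ and $V'$ on $\mathcal K'$ are unitarily equivalent if there is a unitary $U:\mathcal K\to\mathcal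 K'$ with $UV_{i,s}=V'_{i,s}U$ for all $i,s$. For $A\subset\{1,\ldots,k\}$ with complement $A^c=\{j_1<\cdots<j_{k-p}\}$, the $A$-wandering subspace of $V$ is $$\mathcal L_A=\bigcap_{m_{j_1},\ldots,m_{j_{k-p}}=0}^\infty\ \bigoplus_{|\alpha_{j_1}|=m_{j_1}}\cdots\bigoplus_{|\alpha_{j_{k-p}}|=m_{j_{k-p}}}V_{j_1,\alpha_{j_1}}\cdots V_{j_{k-p},\alpha_{j_{k-p}}}\Big(\bigcap_{i\in A,\,1\le s\le n_i}\ker V_{i,s}^*\Big),$$ with $\alpha_j\in\mathbb F_{n_j}^+$ (for $A=\emptyset$ the intersection of kernels is $\mathcal K$; for $A=\{1,\ldots,k\}$, $\mathcal L_A=\bigcap_{i,s}\ker V_{i,s}^*$). It is reducing for all $V_{j,t}$ with $j\in A^c$. The $A$-wandering data of $V$ is $(\mathcal L_A,(V_{j_1}|_{\mathcal L_A},\ldots,V_{j_{k-p}}|_{\mathcal L_A}))$ (just the space $\mathcal L_A$ if $A=\{1,\ldots,k\}$). Two $A$-wandering data $(\mathcal L_1,(W_{j})_{j\in A^c})$, $(\mathcal L_2,(U_j)_{j\in A^c})$ are unitarily equivalent if there is a unitary $\varphi:\mathcal L_1\to\mathcal L_2$ with $\varphi W_{j,t}=U_{j,t}\varphi$ for all $j\in A^c$, $t\in\{1,\ldots,n_j\}$. Spaces may be zero. *)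

theory Defs
  imports "HOL-Analysis.Analysis"
begin

section \<open>Complex Hilbert spaces and bounded operators\<close>

text \<open>The distribution only has real inner product spaces.  A complex Hilbert space is a complete
  real inner product space with a compatible complex scalar multiplication and a sesquilinear form
  (linear in the first argument) whose real part is the real inner product; in particular
  the norm of \<open>x\<close> is \<open>sqrt (Re (cinner x x))\<close>.  The zero space is allowed.\<close>

class complex_hilbert_space = real_inner + complete_space +
  fixes scaleC :: "complex \<Rightarrow> 'a \<Rightarrow> 'a"  (infixr \<open>*\<^sub>C\<close> 75)
    and cinner :: "'a \<Rightarrow> 'a \<Rightarrow> complex"
  assumes scaleC_add_right: "a *\<^sub>C (x + y) = a *\<^sub>C x + a *\<^sub>C y"
    and scaleC_add_left: "(a + b) *\<^sub>C x = a *\<^sub>C x + b *\<^sub>C x"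
    and scaleC_scaleC: "a *\<^sub>C (b *\<^sub>C x) = (a * b) *\<^sub>C x"
    and scaleR_scaleC: "r *\<^sub>R x = complex_of_real r *\<^sub>C x"
    and cinner_commute: "cinner x y = cnj (cinner y x)"
    and cinner_add_left: "cinner (x + y) z = cinner x z + cinner y z"
    and cinner_scaleC_left: "cinner (a *\<^sub>C x) y = a * cinner x y"
    and inner_eq_Re_cinner: "inner x y = Re (cinner x y)"

subclass (in complex_hilbert_space) banach ..

instantiation complex :: complex_hilbert_space
begin

definition scaleC_complex :: "complex \<Rightarrow> complex \<Rightarrow> complex"
  where "scaleC_complex a x = a * x"

definition cinner_complex :: "complex \<Rightarrow> complex \<Rightarrow> complex"
  where "cinner_complex x y = x * cnj y"

instance
  by standard
    (simp_all add: scaleC_complex_def cinner_complex_def inner_complex_def scaleR_conv_of_real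
      algebra_simps)

end

definition bounded_clinear ::
    "('a::complex_hilbert_space \<Rightarrow> 'b::complex_hilbert_space) \<Rightarrow> bool"
  where "bounded_clinear T \<longleftrightarrow> bounded_linear T \<and> (\<forall>c x. T (c *\<^sub>C x) = c *\<^sub>C T x)"

definition cadjoint ::
    "('a::complex_hilbert_space \<Rightarrow> 'b::complex_hilbert_space) \<Rightarrow> 'b \<Rightarrow> 'a"
  where "cadjoint T = (THE S. \<forall>x y. cinner (T x) y = cinner x (S y))"

lemma riesz_real:
  fixes f :: "'a::{real_inner,complete_space} \<Rightarrow> real"
  assumes f: "bounded_linear f"
  shows "\<exists>z. \<forall>x. f x = inner x z"
proof (cases "\<forall>x. f x = 0")
  case True
  then show ?thesis by (intro exI[of _ 0]) simp
next
  case False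
  interpret f: bounded_linear f by fact
  obtain v where v: "f v \<noteq> 0" using False by blast
  define C where "C = {x. f x = 1}"
  have Cne: "v /\<^sub>R f v \<in> C" using v by (simp add: C_def f.scaleR)
  define d where "d = Inf (norm ` C)"
  have bdd: "bdd_below (norm ` C)" by (rule bdd_belowI[of _ 0]) auto
  have d_le: "d \<le> norm x" if "x \<in> C" for x
    unfolding d_def using bdd that by (intro cInf_lower) auto
  have d0: "0 \<le> d" unfolding d_def using Cne by (intro cInf_greatest) auto
  have "\<exists>x\<in>C. norm x < d + 1 / Suc n" for n
  proof -
    have "Inf (norm ` C) < d + 1 / Suc n" by (simp add: d_def)
    then show ?thesis using Cne bdd by (subst (asm) cInf_less_iff) auto
  qed
  then obtain X where X: "\<And>n. X n \<in> C" "\<And>n. norm (X n) < d + 1 / Suc n" by metis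
  have par: "(norm (x - y))\<^sup>2 \<le> 2 * (norm x)\<^sup>2 + 2 * (norm y)\<^sup>2 - 4 * d\<^sup>2"
    if "x \<in> C" "y \<in> C" for x y
  proof -
    have "(1/2) *\<^sub>R (x + y) \<in> C" using that by (simp add: C_def f.add f.scaleR)
    from d_le[OF this] have "d \<le> norm (x + y) / 2" by simp
    then have "d\<^sup>2 \<le> (norm (x + y) / 2)\<^sup>2" using d0 by (rule power_mono)
    then have "4 * d\<^sup>2 \<le> (norm (x + y))\<^sup>2" by (simp add: power_divide)
    then show ?thesis
      by (simp add: power2_norm_eq_inner inner_add inner_diff inner_commute algebra_simps)
  qed
  have lim: "(\<lambda>n. norm (X n)) \<longlonglongrightarrow> d"
  proof (rule tendsto_sandwich[of "\<lambda>_. d" _ _ "\<lambda>n. d + 1 / Suc n"])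
    show "\<forall>\<^sub>F n in sequentially. d \<le> norm (X n)" using d_le X(1) by simp
    show "\<forall>\<^sub>F n in sequentially. norm (X n) \<le> d + 1 / Suc n" using X(2) by (simp add: less_imp_le)
    show "(\<lambda>n. d + 1 / Suc n) \<longlonglongrightarrow> d"
      using tendsto_add[OF tendsto_const LIMSEQ_inverse_real_of_nat, of d]
      by (simp add: inverse_eq_divide)
  qed simp
  have "Cauchy X"
  proof (rule metric_CauchyI)
    fix e :: real assume e: "0 < e"
    have "(\<lambda>n. (norm (X n))\<^sup>2) \<longlonglongrightarrow> d\<^sup>2" using lim by (rule tendsto_power)
    then have "\<forall>\<^sub>F n in sequentially. (norm (X n))\<^sup>2 < d\<^sup>2 + e\<^sup>2 / 4"
      using e by (intro order_tendstoD(2)) auto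
    then obtain N where N: "\<And>n. n \<ge> N \<Longrightarrow> (norm (X n))\<^sup>2 < d\<^sup>2 + e\<^sup>2 / 4"
      unfolding eventually_sequentially by blast
    show "\<exists>M. \<forall>m\<ge>M. \<forall>n\<ge>M. dist (X m) (X n) < e"
    proof (intro exI allI impI)
      fix m n assume "N \<le> m" "N \<le> n"
      then have "(norm (X m - X n))\<^sup>2 < e\<^sup>2"
        using par[OF X(1) X(1), of m n] N[of m] N[of n] by (simp add: field_simps)
      then show "dist (X m) (X n) < e"
        using e by (simp add: dist_norm power_less_imp_less_base)
    qed
  qed
  then obtain w where w: "X \<longlonglongrightarrow> w" using Cauchy_convergent convergent_def by blast
  have fw: "f w = 1"
  proof -
    have "(\<lambda>n. f (X n)) \<longlonglongrightarrow> f w" using w by (rule f.tendsto)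
    moreover have "f (X n) = 1" for n using X(1)[of n] by (simp add: C_def)
    ultimately show ?thesis by (simp add: LIMSEQ_const_iff)
  qed
  have nw: "norm w = d" using lim tendsto_norm[OF w] LIMSEQ_unique by blast
  have orth: "inner u w = 0" if "f u = 0" for u
  proof (cases "u = 0")
    case False
    define t where "t = - inner u w / inner u u"
    have uu: "inner u u > 0" using False by simp
    have "w + t *\<^sub>R u \<in> C" using that fw by (simp add: C_def f.add f.scaleR)
    from d_le[OF this] have "norm w \<le> norm (w + t *\<^sub>R u)" using nw by simp
    then have "(norm w)\<^sup>2 \<le> (norm (w + t *\<^sub>R u))\<^sup>2" by (rule power_mono) simp
    then have "0 \<le> 2 * t * inner u w + t * t * inner u u"
      by (simp add: power2_norm_eq_inner inner_add inner_commute algebra_simps)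
    also have "\<dots> = - (inner u w)\<^sup>2 / inner u u"
      using uu by (simp add: t_def field_simps power2_eq_square)
    finally show ?thesis using uu by (simp add: field_simps)
  qed simp
  have w0: "inner w w \<noteq> 0" using fw f.zero by force
  have "f x = inner x (w /\<^sub>R inner w w)" for x
  proof -
    have "inner (x - f x *\<^sub>R w) w = 0" by (rule orth) (simp add: f.diff f.scaleR fw)
    then show ?thesis using w0 by (simp add: inner_diff_left field_simps)
  qed
  then show ?thesis by blast
qed

lemma cinner_eqI:
  fixes a b :: "'a::complex_hilbert_space"
  assumes "\<And>x. cinner x a = cinner x b"
  shows "a = b"
proof -
  have "inner (a - b) a = inner (a - b) b" using assms by (simp add: inner_eq_Re_cinner)
  then have "inner (a - b) (a - b) = 0" by (simp add: inner_diff_right)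
  then show ?thesis by simp
qed

lemma cinner_cadjoint:
  assumes T: "bounded_clinear T"
  shows "cinner (T x) y = cinner x (cadjoint T y)"
proof -
  have "\<exists>z. \<forall>x. inner (T x) y = inner x z" for y
  proof (rule riesz_real)
    show "bounded_linear (\<lambda>x. inner (T x) y)"
      using T bounded_linear_compose[OF bounded_linear_inner_left]
      by (auto simp: bounded_clinear_def)
  qed
  then obtain S where S: "\<And>x y. inner (T x) y = inner x (S y)" by metis
  have S': "cinner (T x) y = cinner x (S y)" for x y
  proof (rule complex_eqI)
    show "Re (cinner (T x) y) = Re (cinner x (S y))" using S by (simp add: inner_eq_Re_cinner)
    have "Re (cinner (T (\<i> *\<^sub>C x)) y) = Re (cinner (\<i> *\<^sub>C x) (S y))"
      using S by (simp flip: inner_eq_Re_cinner)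
    then show "Im (cinner (T x) y) = Im (cinner x (S y))"
      using T by (simp add: bounded_clinear_def cinner_scaleC_left)
  qed
  have "cadjoint T = S"
    unfolding cadjoint_def
  proof (rule the_equality)
    show "\<forall>x y. cinner (T x) y = cinner x (S y)" using S' by blast
  next
    fix S1 assume S1: "\<forall>x y. cinner (T x) y = cinner x (S1 y)"
    show "S1 = S"
    proof
      show "S1 y = S y" for y by (rule cinner_eqI) (simp flip: S' S1[rule_format])
    qed
  qed
  then show ?thesis using S' by simp
qed

text \<open>Unitary operators between subspaces \<open>S\<close> and \<open>T\<close>; the values of \<open>u\<close> outside \<open>S\<close> are
  irrelevant.\<close>

definition unitary_between ::
    "'a::complex_hilbert_space set \<Rightarrow> 'b::complex_hilbert_space set \<Rightarrow> ('a \<Rightarrow> 'b) \<Rightarrow> bool"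
  where "unitary_between S T u \<longleftrightarrow>
    (\<forall>x\<in>S. \<forall>y\<in>S. u (x + y) = u x + u y) \<and>
    (\<forall>c. \<forall>x\<in>S. u (c *\<^sub>C x) = c *\<^sub>C u x) \<and>
    (\<forall>x\<in>S. \<forall>y\<in>S. cinner (u x) (u y) = cinner x y) \<and>
    bij_betw u S T"

section \<open>Doubly commuting row isometries\<close>

text \<open>A tuple of rows is a function \<open>V\<close> with \<open>V i s\<close> the operator \<open>V\<^sub>i\<^sub>,\<^sub>s\<close>, relevant for
  \<open>i \<in> {1..k}\<close> and \<open>s \<in> {1..n i}\<close>; likewise \<open>lam i j s t\<close> is the \<open>(s, t)\<close> entry of the matrix
  with index \<open>(i, j)\<close>, relevant for \<open>i \<noteq> j\<close>.\<close>

definition unimodular_system ::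
    "nat \<Rightarrow> (nat \<Rightarrow> nat) \<Rightarrow> (nat \<Rightarrow> nat \<Rightarrow> nat \<Rightarrow> nat \<Rightarrow> complex) \<Rightarrow> bool"
  where "unimodular_system k n lam \<longleftrightarrow>
    (\<forall>i\<in>{1..k}. \<forall>j\<in>{1..k}. i \<noteq> j \<longrightarrow>
      (\<forall>s\<in>{1..n i}. \<forall>t\<in>{1..n j}.
        cmod (lam i j s t) = 1 \<and> lam j i t s = cnj (lam i j s t)))"

definition row_isometry :: "nat \<Rightarrow> (nat \<Rightarrow> 'a::complex_hilbert_space \<Rightarrow> 'a) \<Rightarrow> bool"
  where "row_isometry m W \<longleftrightarrow>
    (\<forall>s\<in>{1..m}. bounded_clinear (W s)) \<and>
    (\<forall>s\<in>{1..m}. \<forall>t\<in>{1..m}. \<forall>x. cadjoint (W s) (W t x) = (if s = t then x else 0))"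

definition doubly_commuting_row_isometries ::
    "nat \<Rightarrow> (nat \<Rightarrow> nat) \<Rightarrow> (nat \<Rightarrow> nat \<Rightarrow> nat \<Rightarrow> nat \<Rightarrow> complex) \<Rightarrow>
      (nat \<Rightarrow> nat \<Rightarrow> 'a::complex_hilbert_space \<Rightarrow> 'a) \<Rightarrow> bool"
  where "doubly_commuting_row_isometries k n lam V \<longleftrightarrow>
    (\<forall>i\<in>{1..k}. row_isometry (n i) (V i)) \<and>
    (\<forall>i\<in>{1..k}. \<forall>j\<in>{1..k}. i \<noteq> j \<longrightarrow>
      (\<forall>s\<in>{1..n i}. \<forall>t\<in>{1..n j}. \<forall>x.
        cadjoint (V i s) (V j t x) = cnj (lam i j s t) *\<^sub>C V j t (cadjoint (V i s) x)))"

definition tuples_unitarily_equivalent ::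
    "nat \<Rightarrow> (nat \<Rightarrow> nat) \<Rightarrow> (nat \<Rightarrow> nat \<Rightarrow> 'a::complex_hilbert_space \<Rightarrow> 'a) \<Rightarrow>
      (nat \<Rightarrow> nat \<Rightarrow> 'b::complex_hilbert_space \<Rightarrow> 'b) \<Rightarrow> bool"
  where "tuples_unitarily_equivalent k n V V' \<longleftrightarrow>
    (\<exists>U. unitary_between UNIV UNIV U \<and>
      (\<forall>i\<in>{1..k}. \<forall>s\<in>{1..n i}. \<forall>x. U (V i s x) = V' i s (U x)))"

section \<open>Wandering data\<close>

text \<open>An element of length \<open>l\<close> of the free semigroup on \<open>m\<close> generators is a list of length \<open>l\<close>
  over \<open>{1..m}\<close>; the empty list is the neutral element.\<close>

definition words :: "nat \<Rightarrow> nat \<Rightarrow> nat list set"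
  where "words m l = {w. set w \<subseteq> {1..m} \<and> length w = l}"

definition word_op :: "(nat \<Rightarrow> 'a \<Rightarrow> 'a) \<Rightarrow> nat list \<Rightarrow> 'a \<Rightarrow> 'a"
  where "word_op W w = foldr (\<lambda>p T. W p \<circ> T) w id"

text \<open>The composition of the operators \<open>V\<^sub>j\<^sub>,\<^sub>\<alpha>\<^sub>(\<^sub>j\<^sub>)\<close> for \<open>j\<close> in \<open>J\<close>, the smallest
  index being outermost.\<close>

definition multiword_op :: "(nat \<Rightarrow> nat \<Rightarrow> 'a \<Rightarrow> 'a) \<Rightarrow> nat set \<Rightarrow> (nat \<Rightarrow> nat list) \<Rightarrow> 'a \<Rightarrow> 'a"
  where "multiword_op V J \<alpha> = foldr (\<lambda>j T. word_op (V j) (\<alpha> j) \<circ> T) (sorted_list_of_set J) id"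

definition joint_kernel ::
    "(nat \<Rightarrow> nat) \<Rightarrow> (nat \<Rightarrow> nat \<Rightarrow> 'a::complex_hilbert_space \<Rightarrow> 'a) \<Rightarrow> nat set \<Rightarrow> 'a set"
  where "joint_kernel n V A = (\<Inter>i\<in>A. \<Inter>s\<in>{1..n i}. {x. cadjoint (V i s) x = 0})"

text \<open>The sum of a finite family of subspaces.  It is used below only for the pairwise
  orthogonal closed subspaces \<open>multiword_op V J \<alpha> ` joint_kernel n V A\<close>, for which it is the
  (automatically closed) orthogonal direct sum.\<close>

definition subspace_sum :: "'i set \<Rightarrow> ('i \<Rightarrow> 'a::comm_monoid_add set) \<Rightarrow> 'a set"
  where "subspace_sum I S = {\<Sum>i\<in>I. x i | x. \<forall>i\<in>I. x i \<in> S i}"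

text \<open>The iterated sums over words of prescribed lengths \<open>m j\<close>, for \<open>j\<close> in the complement \<open>J\<close> of
  \<open>A\<close>, are merged into one sum over the families of such words; the values of \<open>m\<close> outside \<open>J\<close>
  play no role.\<close>

definition wandering_subspace ::
    "nat \<Rightarrow> (nat \<Rightarrow> nat) \<Rightarrow> (nat \<Rightarrow> nat \<Rightarrow> 'a::complex_hilbert_space \<Rightarrow> 'a) \<Rightarrow> nat set \<Rightarrow> 'a set"
  where "wandering_subspace k n V A =
    (let J = {1..k} - A in
      \<Inter>m :: nat \<Rightarrow> nat.
        subspace_sum (\<Pi>\<^sub>E j\<in>J. words (n j) (m j))
          (\<lambda>\<alpha>. multiword_op V J \<alpha> ` joint_kernel n V A))"

text \<open>Wandering data for \<open>A\<close> consist of a space and operators \<open>W j t\<close> on it, of which only those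
  with \<open>j\<close> in the complement of \<open>A\<close> are taken into account.\<close>

definition wandering_data ::
    "nat \<Rightarrow> (nat \<Rightarrow> nat) \<Rightarrow> (nat \<Rightarrow> nat \<Rightarrow> 'a::complex_hilbert_space \<Rightarrow> 'a) \<Rightarrow> nat set \<Rightarrow>
      'a set \<times> (nat \<Rightarrow> nat \<Rightarrow> 'a \<Rightarrow> 'a)"
  where "wandering_data k n V A =
    (wandering_subspace k n V A, \<lambda>j t. restrict (V j t) (wandering_subspace k n V A))"

definition wandering_data_equivalent ::
    "nat \<Rightarrow> (nat \<Rightarrow> nat) \<Rightarrow> nat set \<Rightarrow>
      'a::complex_hilbert_space set \<times> (nat \<Rightarrow> nat \<Rightarrow> 'a \<Rightarrow> 'a) \<Rightarrow>
      'b::complex_hilbert_space set \<times> (nat \<Rightarrow> nat \<Rightarrow> 'b \<Rightarrow> 'b) \<Rightarrow> bool"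
  where "wandering_data_equivalent k n A D D' \<longleftrightarrow>
    (\<exists>\<phi>. unitary_between (fst D) (fst D') \<phi> \<and>
      (\<forall>j\<in>{1..k} - A. \<forall>t\<in>{1..n j}. \<forall>x\<in>fst D. \<phi> (snd D j t x) = snd D' j t (\<phi> x)))"

end

theory Submission
  imports Defs
begin

text \<open>A unitary \<open>U\<close> intertwining \<open>V\<close> and \<open>V'\<close> also intertwines the adjoints, hence restricts to the
  wandering subspaces.  Conversely, given equivalences \<open>\<phi>\<^sub>A\<close> of the wandering data, the graph of \<open>U\<close> is
  the closure of the smallest subspace \<open>G\<close> of pairs that contains all \<open>(x, \<phi>\<^sub>A x)\<close> with \<open>x\<close> in a
  wandering subspace and is invariant under all \<open>(V\<^sub>i\<^sub>,\<^sub>s, V'\<^sub>i\<^sub>,\<^sub>s)\<close>.  Double commutation makes \<open>G\<close>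
  invariant under the adjoints as well, which reduces its isometry to the wandering subspaces.
  The two projections of the closure are closed reducing subspaces containing all wandering
  subspaces; by the Wold decomposition, here in the form that a reducing subspace orthogonal to
  all wandering subspaces is zero, they are the whole spaces.\<close>

section \<open>Closed subspaces and adjoints\<close>

text \<open>A sequence in \<open>S\<close> minimising the distance to \<open>x\<close> converges to
  a nearest point \<open>p\<close>, and \<open>x - p\<close> is the required vector.\<close>

lemma exists_orthogonal_vector:
  fixes S :: "'a::{real_inner,complete_space} set"
  assumes S: "subspace S" "closed S" and x: "x \<notin> S"
  shows "\<exists>z. z \<noteq> 0 \<and> (\<forall>y\<in>S. inner y z = 0)"
proof -
  define d where "d = infdist x S"
  have ne: "S \<noteq> {}" using subspace_0[OF S(1)] by blast
  have d0: "0 \<le> d" by (simp add: d_def infdist_nonneg)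
  have d_le: "d \<le> norm (x - y)" if "y \<in> S" for y
    using infdist_le[OF that, of x] by (simp add: d_def dist_norm)
  have "\<exists>y\<in>S. norm (x - y) < d + 1 / Suc n" for n
  proof (rule ccontr)
    assume "\<not> ?thesis"
    then have "d + 1 / Suc n \<le> infdist x S"
      unfolding infdist_notempty[OF ne] using ne
      by (intro cINF_greatest) (auto simp: dist_norm not_less)
    then show False by (simp add: d_def)
  qed
  then obtain Y where Y: "\<And>n. Y n \<in> S" "\<And>n. norm (x - Y n) < d + 1 / Suc n" by metis
  \<comment> \<open>The parallelogram law: the midpoint of \<open>y\<close> and \<open>z\<close>
    lies in \<open>S\<close>, hence has distance at least \<open>d\<close> from
    \<open>x\<close>.\<close>
  have par: "(norm (y - z))\<^sup>2 \<le> 2 * (norm (x - y))\<^sup>2 + 2 * (norm (x - z))\<^sup>2 - 4 * d\<^sup>2"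
    if "y \<in> S" "z \<in> S" for y z
  proof -
    have "(1/2) *\<^sub>R (y + z) \<in> S" using that S(1) by (simp add: subspace_add subspace_scale)
    from power_mono[OF d_le[OF this] d0, of 2]
    have "4 * d\<^sup>2 \<le> 4 * (norm (x - (1/2) *\<^sub>R (y + z)))\<^sup>2" by simp
    also have "\<dots> = 2 * (norm (x - y))\<^sup>2 + 2 * (norm (x - z))\<^sup>2 - (norm (y - z))\<^sup>2"
      by (simp add: power2_norm_eq_inner inner_add inner_diff inner_commute algebra_simps)
    finally show ?thesis by simp
  qed
  have lim: "(\<lambda>n. norm (x - Y n)) \<longlonglongrightarrow> d"
  proof (rule tendsto_sandwich[of "\<lambda>_. d" _ _ "\<lambda>n. d + 1 / Suc n"])
    show "(\<lambda>n. d + 1 / Suc n) \<longlonglongrightarrow> d"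
      using tendsto_add[OF tendsto_const LIMSEQ_inverse_real_of_nat, of d]
      by (simp add: inverse_eq_divide)
  qed (use d_le Y in \<open>auto simp: less_imp_le\<close>)
  have "Cauchy Y"
  proof (rule metric_CauchyI)
    fix e :: real assume e: "0 < e"
    have "(\<lambda>n. (norm (x - Y n))\<^sup>2) \<longlonglongrightarrow> d\<^sup>2" using lim by (rule tendsto_power)
    then have "\<forall>\<^sub>F n in sequentially. (norm (x - Y n))\<^sup>2 < d\<^sup>2 + e\<^sup>2 / 4"
      using e by (intro order_tendstoD(2)) auto
    then obtain N where N: "\<And>n. n \<ge> N \<Longrightarrow> (norm (x - Y n))\<^sup>2 < d\<^sup>2 + e\<^sup>2 / 4"
      unfolding eventually_sequentially by blast
    show "\<exists>M. \<forall>m\<ge>M. \<forall>n\<ge>M. dist (Y m) (Y n) < e"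
    proof (intro exI allI impI)
      fix m n assume "N \<le> m" "N \<le> n"
      then have "(norm (Y m - Y n))\<^sup>2 < e\<^sup>2"
        using par[OF Y(1) Y(1), of m n] N[of m] N[of n] by (simp add: field_simps)
      then show "dist (Y m) (Y n) < e"
        using e by (simp add: dist_norm power_less_imp_less_base)
    qed
  qed
  then obtain p where p: "Y \<longlonglongrightarrow> p" using Cauchy_convergent convergent_def by blast
  have pS: "p \<in> S" using closed_sequentially[OF S(2)] Y(1) p by blast
  have np: "norm (x - p) = d"
    using lim tendsto_norm[OF tendsto_diff[OF tendsto_const p]] LIMSEQ_unique by blast
  have "inner u (x - p) = 0" if u: "u \<in> S" for u
  proof (cases "u = 0")
    case False
    \<comment> \<open>The minimiser of the quadratic in \<open>t\<close> expanded below; minimality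
      of \<open>p\<close> then makes minus a square nonnegative.\<close>
    define t where "t = inner u (x - p) / inner u u"
    have uu: "inner u u > 0" using False by simp
    have "p + t *\<^sub>R u \<in> S" using u pS S(1) by (simp add: subspace_add subspace_scale)
    from d_le[OF this] have "norm (x - p) \<le> norm ((x - p) - t *\<^sub>R u)"
      using np by (simp add: algebra_simps)
    then have "(norm (x - p))\<^sup>2 \<le> (norm ((x - p) - t *\<^sub>R u))\<^sup>2" by (rule power_mono) simp
    also have "\<dots> = (norm (x - p))\<^sup>2 - 2 * t * inner u (x - p) + t * t * inner u u"
      unfolding power2_norm_eq_inner
      by (simp add: inner_diff_left inner_diff_right inner_commute algebra_simps)
    finally have "0 \<le> - 2 * t * inner u (x - p) + t * t * inner u u" by simp
    also have "\<dots> = - (inner u (x - p))\<^sup>2 / inner u u"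
      using uu by (simp add: t_def field_simps power2_eq_square)
    finally show ?thesis using uu by (simp add: field_simps)
  qed simp
  moreover have "x - p \<noteq> 0" using pS x by auto
  ultimately show ?thesis by blast
qed

section \<open>Arithmetic of complex scalars, inner products and adjoints\<close>

lemma scaleC_one [simp]: "1 *\<^sub>C (x::'a::complex_hilbert_space) = x"
  using scaleR_scaleC[of 1 x] by simp

lemma scaleC_zero_left [simp]: "0 *\<^sub>C (x::'a::complex_hilbert_space) = 0"
  using scaleR_scaleC[of 0 x] by simp

lemma scaleC_zero_right [simp]: "c *\<^sub>C (0::'a::complex_hilbert_space) = 0"
  using scaleC_add_right[of c 0 "0::'a"] by simp

lemma scaleC_minus_one: "(- 1) *\<^sub>C (x::'a::complex_hilbert_space) = - x"
  using scaleR_scaleC[of "- 1" x] by simp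

lemma scaleC_sum:
  fixes f :: "'i \<Rightarrow> 'a::complex_hilbert_space"
  shows "c *\<^sub>C (\<Sum>i\<in>I. f i) = (\<Sum>i\<in>I. c *\<^sub>C f i)"
  by (induction I rule: infinite_finite_induct) (simp_all add: scaleC_add_right)

lemma cinner_add_right:
  "cinner (x::'a::complex_hilbert_space) (y + z) = cinner x y + cinner x z"
  by (metis cinner_add_left cinner_commute complex_cnj_add)

lemma cinner_scaleC_right: "cinner (x::'a::complex_hilbert_space) (c *\<^sub>C y) = cnj c * cinner x y"
  by (metis cinner_commute cinner_scaleC_left complex_cnj_mult)

lemma cinner_zero_left [simp]: "cinner 0 (x::'a::complex_hilbert_space) = 0"
  using cinner_add_left[of 0 0 x] by simp

lemma cinner_zero_right [simp]: "cinner (x::'a::complex_hilbert_space) 0 = 0"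
  using cinner_add_right[of x 0 0] by simp

lemma cinner_diff_left:
  "cinner (x - y) (z::'a::complex_hilbert_space) = cinner x z - cinner y z"
  using cinner_add_left[of "x - y" y z] by simp

lemma cinner_diff_right:
  "cinner (x::'a::complex_hilbert_space) (y - z) = cinner x y - cinner x z"
  using cinner_add_right[of x "y - z" z] by simp

lemma cinner_sum_right:
  fixes f :: "'i \<Rightarrow> 'a::complex_hilbert_space"
  shows "cinner x (\<Sum>i\<in>I. f i) = (\<Sum>i\<in>I. cinner x (f i))"
  by (induction I rule: infinite_finite_induct) (simp_all add: cinner_add_right)

text \<open>Recovers the complex inner product from the real one, so that a map preserving the real
  inner product and complex scalars is isometric in the complex sense.\<close>

lemma Im_cinner: "Im (cinner x y) = - inner (\<i> *\<^sub>C x) (y::'a::complex_hilbert_space)"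
  by (simp add: inner_eq_Re_cinner cinner_scaleC_left)

lemma norm_eq_sqrt_cinner: "norm (x::'a::complex_hilbert_space) = sqrt (Re (cinner x x))"
  by (simp add: norm_eq_sqrt_inner inner_eq_Re_cinner)

lemma cinner_self_eq_0D: "cinner x x = 0 \<Longrightarrow> (x::'a::complex_hilbert_space) = 0"
  using norm_eq_sqrt_cinner[of x] by simp

lemma norm_scaleC: "norm (c *\<^sub>C (x::'a::complex_hilbert_space)) = cmod c * norm x"
proof -
  have "cinner (c *\<^sub>C x) (c *\<^sub>C x) = complex_of_real ((cmod c)\<^sup>2) * cinner x x"
    unfolding complex_norm_square by (simp add: cinner_scaleC_left cinner_scaleC_right)
  then have "inner (c *\<^sub>C x) (c *\<^sub>C x) = (cmod c)\<^sup>2 * inner x x"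
    unfolding inner_eq_Re_cinner by (simp del: of_real_power)
  then show ?thesis by (simp add: norm_eq_sqrt_inner real_sqrt_mult)
qed

lemma bounded_clinear_scaleC:
  "bounded_clinear (\<lambda>x::'a::complex_hilbert_space. c *\<^sub>C x)"
  unfolding bounded_clinear_def
proof (intro conjI allI)
  show "bounded_linear (\<lambda>x::'a. c *\<^sub>C x)"
    by (rule bounded_linear_intro[of _ "cmod c"])
      (simp_all add: scaleC_add_right scaleR_scaleC scaleC_scaleC norm_scaleC mult.commute)
qed (simp add: scaleC_scaleC mult.commute)

lemma bounded_clinear_simps:
  assumes "bounded_clinear T"
  shows "T (x + y) = T x + T y" "T (x - y) = T x - T y" "T (c *\<^sub>C x) = c *\<^sub>C T x" "T 0 = 0"
    "T (\<Sum>i\<in>I. f i) = (\<Sum>i\<in>I. T (f i))" "continuous_on S T"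
proof -
  interpret T: bounded_linear T using assms by (simp add: bounded_clinear_def)
  show "T (x + y) = T x + T y" "T (x - y) = T x - T y" "T 0 = 0"
    "T (\<Sum>i\<in>I. f i) = (\<Sum>i\<in>I. T (f i))" "continuous_on S T"
    by (simp_all add: T.add T.diff T.zero T.sum T.continuous_on)
  show "T (c *\<^sub>C x) = c *\<^sub>C T x" using assms by (simp add: bounded_clinear_def)
qed

lemma cinner_cadjoint_left:
  assumes "bounded_clinear T"
  shows "cinner (cadjoint T y) x = cinner y (T x)"
  using cinner_cadjoint[OF assms] by (metis cinner_commute)

text \<open>Linearity follows by testing against all vectors. A bound \<open>K\<close> for
  \<open>T\<close> carries over: apply Cauchy-Schwarz to \<open>inner (T ?z) y\<close> with
  \<open>?z = cadjoint T y\<close> and cancel \<open>norm ?z\<close>.\<close>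

lemma bounded_clinear_cadjoint:
  fixes T :: "'a::complex_hilbert_space \<Rightarrow> 'b::complex_hilbert_space"
  assumes T: "bounded_clinear T"
  shows "bounded_clinear (cadjoint T)"
proof -
  have add: "cadjoint T (x + y) = cadjoint T x + cadjoint T y" for x y
    by (rule cinner_eqI) (simp add: cinner_add_right flip: cinner_cadjoint[OF T])
  have scale: "cadjoint T (c *\<^sub>C x) = c *\<^sub>C cadjoint T x" for c x
    by (rule cinner_eqI) (simp add: cinner_scaleC_right flip: cinner_cadjoint[OF T])
  obtain K where K: "0 \<le> K" "\<And>x. norm (T x) \<le> norm x * K"
    using T bounded_linear.nonneg_bounded unfolding bounded_clinear_def by blast
  have "norm (cadjoint T y) \<le> norm y * K" for y
  proof -
    let ?z = "cadjoint T y"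
    have "norm ?z * norm ?z = inner (T ?z) y"
      by (simp add: inner_eq_Re_cinner cinner_cadjoint[OF T] flip: norm_eq_sqrt_cinner
          power2_norm_eq_inner power2_eq_square)
         (simp add: power2_norm_eq_inner inner_eq_Re_cinner)
    also have "\<dots> \<le> norm (T ?z) * norm y" by (rule norm_cauchy_schwarz)
    also have "\<dots> \<le> norm ?z * (norm y * K)"
      using mult_right_mono[OF K(2)[of ?z], of "norm y"] by (simp add: mult_ac)
    finally show ?thesis
      using K(1) by (cases "?z = 0") (simp_all add: mult_le_cancel_left_pos)
  qed
  then show ?thesis
    unfolding bounded_clinear_def
    by (auto simp: add scale scaleR_scaleC intro!: bounded_linear_intro[of _ K])
qed

section \<open>Complex subspaces\<close>

definition csubspace :: "'a::complex_hilbert_space set \<Rightarrow> bool"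
  where "csubspace S \<longleftrightarrow>
    0 \<in> S \<and> (\<forall>x\<in>S. \<forall>y\<in>S. x + y \<in> S) \<and> (\<forall>c. \<forall>x\<in>S. c *\<^sub>C x \<in> S)"

lemma csubspaceD:
  assumes "csubspace S"
  shows "0 \<in> S" "x \<in> S \<Longrightarrow> y \<in> S \<Longrightarrow> x + y \<in> S" "x \<in> S \<Longrightarrow> c *\<^sub>C x \<in> S"
    "x \<in> S \<Longrightarrow> y \<in> S \<Longrightarrow> x - y \<in> S" "(\<And>i. i \<in> I \<Longrightarrow> f i \<in> S) \<Longrightarrow> (\<Sum>i\<in>I. f i) \<in> S"
proof -
  show 1: "0 \<in> S" and 2: "\<And>x y. x \<in> S \<Longrightarrow> y \<in> S \<Longrightarrow> x + y \<in> S"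
    and 3: "\<And>c x. x \<in> S \<Longrightarrow> c *\<^sub>C x \<in> S"
    using assms by (auto simp: csubspace_def)
  show "x - y \<in> S" if "x \<in> S" "y \<in> S"
    using 2[OF that(1) 3[OF that(2), of "- 1"]] by (simp add: scaleC_minus_one)
  show "(\<Sum>i\<in>I. f i) \<in> S" if "\<And>i. i \<in> I \<Longrightarrow> f i \<in> S"
    using that by (induction I rule: infinite_finite_induct) (simp_all add: 1 2)
qed

lemma csubspace_Int: "csubspace S \<Longrightarrow> csubspace T \<Longrightarrow> csubspace (S \<inter> T)"
  by (auto simp: csubspace_def)

lemma csubspace_INT: "(\<And>i. i \<in> I \<Longrightarrow> csubspace (S i)) \<Longrightarrow> csubspace (\<Inter>i\<in>I. S i)"
  by (auto simp: csubspace_def)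

section \<open>Ranges of row isometries\<close>

text \<open>For a row isometry this is the orthogonal projection onto the sum of the ranges of the
  \<open>W s\<close>; its kernel is the joint kernel of the adjoints.\<close>

definition range_proj :: "nat \<Rightarrow> (nat \<Rightarrow> 'a::complex_hilbert_space \<Rightarrow> 'a) \<Rightarrow> 'a \<Rightarrow> 'a"
  where "range_proj m W x = (\<Sum>s\<in>{1..m}. W s (cadjoint (W s) x))"

text \<open>For a row isometry \<open>W\<close>, the set \<open>power_range m W N\<close> is the span of the ranges of the operators
  \<open>W\<^sub>\<alpha>\<close> with \<open>\<alpha>\<close> of length \<open>N\<close>; this recursion involves no sum over words.\<close>

primrec power_range :: "nat \<Rightarrow> (nat \<Rightarrow> 'a::complex_hilbert_space \<Rightarrow> 'a) \<Rightarrow> nat \<Rightarrow> 'a set"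
  where
    "power_range m W 0 = UNIV"
  | "power_range m W (Suc N) =
      {x. range_proj m W x = x \<and> (\<forall>s\<in>{1..m}. cadjoint (W s) x \<in> power_range m W N)}"

text \<open>The rows in \<open>B\<close> act on \<open>mixed_part n V A B\<close> as row unitaries.\<close>

definition mixed_part ::
    "(nat \<Rightarrow> nat) \<Rightarrow> (nat \<Rightarrow> nat \<Rightarrow> 'a::complex_hilbert_space \<Rightarrow> 'a) \<Rightarrow> nat set \<Rightarrow> nat set \<Rightarrow> 'a set"
  where "mixed_part n V A B = joint_kernel n V A \<inter> (\<Inter>j\<in>B. \<Inter>N. power_range (n j) (V j) N)"

lemma mixed_part_iff:
  "x \<in> mixed_part n V A B \<longleftrightarrow>
    (\<forall>i\<in>A. \<forall>s\<in>{1..n i}. cadjoint (V i s) x = 0) \<and> (\<forall>j\<in>B. \<forall>N. x \<in> power_range (n j) (V j) N)"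
  by (auto simp: mixed_part_def joint_kernel_def)

section \<open>Commutation relations between operators, adjoints and range projections\<close>

locale doubly_commuting_rows =
  fixes k :: nat
    and n :: "nat \<Rightarrow> nat"
    and lam :: "nat \<Rightarrow> nat \<Rightarrow> nat \<Rightarrow> nat \<Rightarrow> complex"
    and V :: "nat \<Rightarrow> nat \<Rightarrow> 'a::complex_hilbert_space \<Rightarrow> 'a"
  assumes unimodular: "unimodular_system k n lam"
    and doubly_commuting: "doubly_commuting_row_isometries k n lam V"
begin

definition idx :: "nat \<Rightarrow> nat \<Rightarrow> bool"
  where "idx i s \<longleftrightarrow> i \<in> {1..k} \<and> s \<in> {1..n i}"

abbreviation adj :: "nat \<Rightarrow> nat \<Rightarrow> 'a \<Rightarrow> 'a"
  where "adj i s \<equiv> cadjoint (V i s)"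

abbreviation proj :: "nat \<Rightarrow> 'a \<Rightarrow> 'a"
  where "proj i \<equiv> range_proj (n i) (V i)"

abbreviation level :: "nat \<Rightarrow> nat \<Rightarrow> 'a set"
  where "level i \<equiv> power_range (n i) (V i)"

lemma bounded_clinear_V: "idx i s \<Longrightarrow> bounded_clinear (V i s)"
  using doubly_commuting
  by (auto simp: doubly_commuting_row_isometries_def row_isometry_def idx_def)

lemmas V_simps = bounded_clinear_simps[OF bounded_clinear_V]
lemmas adj_simps = bounded_clinear_simps[OF bounded_clinear_cadjoint[OF bounded_clinear_V]]
lemmas cinner_adj = cinner_cadjoint[OF bounded_clinear_V]
lemmas cinner_adj_left = cinner_cadjoint_left[OF bounded_clinear_V]

lemma adj_V_same: "idx i s \<Longrightarrow> idx i t \<Longrightarrow> adj i s (V i t x) = (if s = t then x else 0)"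
  using doubly_commuting
  unfolding doubly_commuting_row_isometries_def row_isometry_def idx_def by blast

lemma adj_V_diff:
  "idx i s \<Longrightarrow> idx j t \<Longrightarrow> i \<noteq> j \<Longrightarrow> adj i s (V j t x) = cnj (lam i j s t) *\<^sub>C V j t (adj i s x)"
  using doubly_commuting by (auto simp: doubly_commuting_row_isometries_def idx_def)

lemma lam_props:
  assumes "idx i s" "idx j t" "i \<noteq> j"
  shows "lam j i t s = cnj (lam i j s t)" "lam i j s t * cnj (lam i j s t) = 1"
    "cnj (lam i j s t) * lam i j s t = 1"
proof -
  have "cmod (lam i j s t) = 1" and 1: "lam j i t s = cnj (lam i j s t)"
    using unimodular assms unfolding unimodular_system_def idx_def by blast+
  then show "lam i j s t * cnj (lam i j s t) = 1" "cnj (lam i j s t) * lam i j s t = 1"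
    using complex_norm_square[of "lam i j s t"] by (simp_all add: mult.commute)
  show "lam j i t s = cnj (lam i j s t)" by fact
qed

text \<open>Double commutation relates adjoints to operators only; the relation between two
  operators follows by expanding the squared norm of the difference of the two sides. All four terms
  are multiples of \<open>cinner x x\<close> and cancel because the scalar is unimodular.\<close>

lemma V_commute:
  assumes "idx i s" "idx j t" "i \<noteq> j"
  shows "V i s (V j t x) = lam i j s t *\<^sub>C V j t (V i s x)"
proof -
  note ij = assms assms(3)[symmetric]
  let ?l = "lam i j s t"
  let ?p = "V i s (V j t x)" and ?q = "V j t (V i s x)"
  have iso: "cinner (V i s y) (V i s z) = cinner y z" if "idx i s" for i s y z
    using that by (simp add: cinner_adj adj_V_same)
  have "cinner ?p ?q = cinner (adj j t ?p) (V i s x)"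
    using ij by (simp add: cinner_adj_left)
  also have "adj j t ?p = ?l *\<^sub>C V i s x"
    using ij by (simp add: adj_V_diff adj_V_same lam_props(1)[of i s j t])
  finally have pq: "cinner ?p ?q = ?l * cinner x x"
    using ij by (simp add: cinner_scaleC_left iso)
  have qp: "cinner ?q ?p = cnj ?l * cinner x x"
    using pq cinner_commute[of ?q ?p] cinner_commute[of x x] by simp
  have "cinner (?p - ?l *\<^sub>C ?q) (?p - ?l *\<^sub>C ?q) = 0"
    using ij lam_props(2,3)[of i s j t]
    by (simp add: cinner_diff_left cinner_diff_right cinner_scaleC_left cinner_scaleC_right
        iso pq qp algebra_simps)
  then show ?thesis using cinner_self_eq_0D by fastforce
qed

lemma adj_commute:
  assumes "idx i s" "idx j t" "i \<noteq> j"
  shows "adj i s (adj j t x) = lam i j s t *\<^sub>C adj j t (adj i s x)"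
proof (rule cinner_eqI)
  fix y
  have "cinner y (adj i s (adj j t x)) = cinner (V j t (V i s y)) x"
    using assms by (simp add: cinner_adj)
  also have "\<dots> = cnj (lam i j s t) * cinner (V i s (V j t y)) x"
    using assms by (simp add: V_commute[of j t i s] lam_props(1)[of i s j t] cinner_scaleC_left)
  finally show "cinner y (adj i s (adj j t x)) = cinner y (lam i j s t *\<^sub>C adj j t (adj i s x))"
    using assms by (simp add: cinner_adj cinner_scaleC_right)
qed

text \<open>The scalars picked up when \<open>V j t\<close> passes \<open>adj i s\<close> and then
  \<open>V i s\<close> are inverse to each other, so the commutation is exact.\<close>

lemma proj_V:
  assumes "idx j t" "i \<in> {1..k}" "i \<noteq> j"
  shows "proj i (V j t x) = V j t (proj i x)"
  unfolding range_proj_def V_simps(5)[OF assms(1)]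
proof (rule sum.cong)
  fix s assume "s \<in> {1..n i}"
  then have s: "idx i s" using assms by (simp add: idx_def)
  show "V i s (adj i s (V j t x)) = V j t (V i s (adj i s x))"
    using assms s
    by (simp add: adj_V_diff V_simps(3) V_commute[of i s j t] scaleC_scaleC lam_props(2,3))
qed simp

lemma proj_adj:
  assumes "idx j t" "i \<in> {1..k}" "i \<noteq> j"
  shows "proj i (adj j t x) = adj j t (proj i x)"
  unfolding range_proj_def adj_simps(5)[OF assms(1)]
proof (rule sum.cong)
  fix s assume "s \<in> {1..n i}"
  then have s: "idx i s" using assms by (simp add: idx_def)
  show "V i s (adj i s (adj j t x)) = adj j t (V i s (adj i s x))"
    using assms s
    by (simp add: adj_V_diff[of j t i s] V_simps(3) adj_commute[of i s j t] lam_props(1)[of i s j t])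
qed simp

lemma proj_simps:
  assumes "i \<in> {1..k}"
  shows "proj i (x + y) = proj i x + proj i y" "proj i (c *\<^sub>C x) = c *\<^sub>C proj i x"
    "proj i 0 = 0"
proof -
  have idx: "idx i s" if "s \<in> {1..n i}" for s using that assms by (simp add: idx_def)
  show "proj i (x + y) = proj i x + proj i y"
    unfolding range_proj_def sum.distrib[symmetric]
    by (rule sum.cong) (simp_all add: V_simps adj_simps idx)
  show "proj i (c *\<^sub>C x) = c *\<^sub>C proj i x"
    unfolding range_proj_def scaleC_sum
    by (rule sum.cong) (simp_all add: V_simps adj_simps idx)
  show "proj i 0 = 0"
    unfolding range_proj_def
    by (rule sum.neutral) (simp add: V_simps adj_simps idx)
qed

text \<open>Consequently the defect \<open>x - proj i x\<close> is annihilated by all adjoints of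
  row \<open>i\<close>.\<close>

lemma adj_proj:
  assumes "idx i s"
  shows "adj i s (proj i x) = adj i s x"
proof -
  have "adj i s (proj i x) = (\<Sum>t\<in>{1..n i}. if s = t then adj i t x else 0)"
    unfolding range_proj_def adj_simps(5)[OF assms]
    by (rule sum.cong) (use assms in \<open>auto simp: adj_V_same idx_def\<close>)
  then show ?thesis using assms by (simp add: idx_def)
qed

lemma proj_V_same:
  assumes "idx i t"
  shows "proj i (V i t x) = V i t x"
proof -
  have "proj i (V i t x) = (\<Sum>s\<in>{1..n i}. if s = t then V i t x else 0)"
    unfolding range_proj_def
    by (rule sum.cong) (use assms in \<open>auto simp: adj_V_same V_simps idx_def\<close>)
  then show ?thesis using assms by (simp add: idx_def)
qed

section \<open>Invariance of the iterated ranges\<close>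

lemma csubspace_level: "i \<in> {1..k} \<Longrightarrow> csubspace (level i N)"
proof (induction N)
  case 0
  show ?case by (simp add: csubspace_def)
next
  case (Suc N)
  have idx: "idx i s" if "s \<in> {1..n i}" for s using that Suc.prems by (simp add: idx_def)
  show ?case
    using csubspaceD[OF Suc.IH[OF Suc.prems]] Suc.prems
    by (auto simp: csubspace_def proj_simps adj_simps idx)
qed

text \<open>Induction on \<open>N\<close>: an operator of another row commutes with
  \<open>proj i\<close>, and with \<open>adj i s\<close> up to a scalar.\<close>

lemma level_V: "idx j t \<Longrightarrow> i \<in> {1..k} \<Longrightarrow> i \<noteq> j \<Longrightarrow> x \<in> level i N \<Longrightarrow> V j t x \<in> level i N"
proof (induction N arbitrary: x)
  case (Suc N)
  have "adj i s (V j t x) \<in> level i N" if "s \<in> {1..n i}" for s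
  proof -
    have "idx i s" using that Suc.prems by (simp add: idx_def)
    moreover have "V j t (adj i s x) \<in> level i N" using Suc that by simp
    ultimately show ?thesis
      using Suc.prems csubspaceD(3)[OF csubspace_level] by (simp add: adj_V_diff)
  qed
  then show ?case using Suc.prems by (simp add: proj_V)
qed simp

lemma level_adj: "idx j t \<Longrightarrow> i \<in> {1..k} \<Longrightarrow> i \<noteq> j \<Longrightarrow> x \<in> level i N \<Longrightarrow> adj j t x \<in> level i N"
proof (induction N arbitrary: x)
  case (Suc N)
  have "adj i s (adj j t x) \<in> level i N" if "s \<in> {1..n i}" for s
  proof -
    have "idx i s" using that Suc.prems by (simp add: idx_def)
    moreover have "adj j t (adj i s x) \<in> level i N" using Suc that by simp
    ultimately show ?thesis
      using Suc.prems csubspaceD(3)[OF csubspace_level] by (simp add: adj_commute[of i s j t])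
  qed
  then show ?case using Suc.prems by (simp add: proj_adj)
qed simp

lemma level_V_Suc: "idx i t \<Longrightarrow> x \<in> level i N \<Longrightarrow> V i t x \<in> level i (Suc N)"
  using csubspaceD(1)[OF csubspace_level]
  by (auto simp: proj_V_same adj_V_same idx_def)

lemma level_mono: "x \<in> level i (Suc N) \<Longrightarrow> x \<in> level i N"
  by (induction N arbitrary: x) auto

section \<open>Joint kernels, mixed parts and the Wold decomposition\<close>

lemma csubspace_joint_kernel: "A \<subseteq> {1..k} \<Longrightarrow> csubspace (joint_kernel n V A)"
  by (auto simp: csubspace_def joint_kernel_def adj_simps idx_def)

lemma joint_kernel_V:
  assumes "A \<subseteq> {1..k}" "idx j t" "j \<notin> A" "x \<in> joint_kernel n V A"
  shows "V j t x \<in> joint_kernel n V A"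
  unfolding joint_kernel_def
proof (intro INT_I CollectI)
  fix i s assume i: "i \<in> A" and s: "s \<in> {1..n i}"
  then have "idx i s" "i \<noteq> j" using assms by (auto simp: idx_def)
  then show "adj i s (V j t x) = 0"
    using assms i s by (simp add: adj_V_diff V_simps joint_kernel_def)
qed

lemma joint_kernel_adj:
  assumes "A \<subseteq> {1..k}" "idx j t" "j \<notin> A" "x \<in> joint_kernel n V A"
  shows "adj j t x \<in> joint_kernel n V A"
  unfolding joint_kernel_def
proof (intro INT_I CollectI)
  fix i s assume i: "i \<in> A" and s: "s \<in> {1..n i}"
  then have "idx i s" "i \<noteq> j" using assms by (auto simp: idx_def)
  then show "adj i s (adj j t x) = 0"
    using assms i s by (simp add: adj_commute[of i s j t] adj_simps joint_kernel_def)
qed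

lemma csubspace_mixed_part:
  "A \<subseteq> {1..k} \<Longrightarrow> B \<subseteq> {1..k} \<Longrightarrow> csubspace (mixed_part n V A B)"
  unfolding mixed_part_def
  by (intro csubspace_Int csubspace_INT csubspace_joint_kernel csubspace_level) auto

lemma mixed_part_V:
  assumes "A \<subseteq> {1..k}" "B \<subseteq> {1..k}" "idx j t" "j \<notin> A" "x \<in> mixed_part n V A B"
  shows "V j t x \<in> mixed_part n V A B"
  unfolding mixed_part_def
proof (intro IntI INT_I)
  show "V j t x \<in> joint_kernel n V A"
    using assms joint_kernel_V by (simp add: mixed_part_def)
  show "V j t x \<in> level i N" if "i \<in> B" for i N
  proof (cases "i = j")
    case True
    \<comment> \<open>An operator raises the level of its own row by one, and the levels are
      decreasing.\<close>
    then show ?thesis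
      using assms level_mono[OF level_V_Suc[OF assms(3)]] that by (simp add: mixed_part_def)
  next
    case False
    then show ?thesis using assms that level_V by (auto simp: mixed_part_def)
  qed
qed

lemma mixed_part_adj:
  assumes "A \<subseteq> {1..k}" "B \<subseteq> {1..k}" "idx j t" "j \<notin> A" "x \<in> mixed_part n V A B"
  shows "adj j t x \<in> mixed_part n V A B"
  unfolding mixed_part_def
proof (intro IntI INT_I)
  show "adj j t x \<in> joint_kernel n V A"
    using assms joint_kernel_adj by (simp add: mixed_part_def)
  show "adj j t x \<in> level i N" if "i \<in> B" for i N
  proof (cases "i = j")
    case True
    \<comment> \<open>The adjoint lowers the level of its own row by one, so the argument starts one
      level higher.\<close>
    have "x \<in> level i (Suc N)" using assms that unfolding mixed_part_def by blast
    then show ?thesis using assms(3) True by (simp add: idx_def)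
  next
    case False
    then show ?thesis using assms that level_adj by (auto simp: mixed_part_def)
  qed
qed

text \<open>Let \<open>N\<close> be the orthogonal complement of \<open>D\<close>, which is again reducing.  By downward induction
  on \<open>A \<union> B\<close>, \<open>N \<inter> mixed_part n V A B = 0\<close>: for \<open>i \<notin> A \<union> B\<close>, the defect \<open>x - proj i x\<close> of
  \<open>x \<in> N \<inter> mixed_part n V A B\<close> lies in \<open>N \<inter> mixed_part n V (insert i A) B = 0\<close>, so that \<open>V i\<close> is a row
  unitary on \<open>N \<inter> mixed_part n V A B\<close>, which is thus contained in
  \<open>N \<inter> mixed_part n V A (insert i B) = 0\<close>.\<close>

lemma reducing_subspace_eq_UNIV:
  assumes D: "subspace D" "closed D"
    and D_V: "\<And>i s x. idx i s \<Longrightarrow> x \<in> D \<Longrightarrow> V i s x \<in> D"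
    and D_adj: "\<And>i s x. idx i s \<Longrightarrow> x \<in> D \<Longrightarrow> adj i s x \<in> D"
    and D_mixed: "\<And>A. A \<subseteq> {1..k} \<Longrightarrow> mixed_part n V A ({1..k} - A) \<subseteq> D"
  shows "D = UNIV"
proof -
  define N where "N = {z. \<forall>x\<in>D. inner x z = 0}"
  have N_diff: "x - y \<in> N" if "x \<in> N" "y \<in> N" for x y
    using that by (simp add: N_def inner_diff_right)
  \<comment> \<open>Passing to the orthogonal complement exchanges the roles of operators and
    adjoints.\<close>
  have N_V: "V i s x \<in> N" if "x \<in> N" "idx i s" for i s x
    using that D_adj by (simp add: N_def inner_eq_Re_cinner flip: cinner_adj_left)
  have N_adj: "adj i s x \<in> N" if "x \<in> N" "idx i s" for i s x
    using that D_V by (simp add: N_def inner_eq_Re_cinner flip: cinner_adj)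
  have N_sum: "(\<Sum>i\<in>I. f i) \<in> N" if "\<And>i. i \<in> I \<Longrightarrow> f i \<in> N" for I and f :: "nat \<Rightarrow> 'a"
    using that by (induction I rule: infinite_finite_induct) (auto simp: N_def inner_add_right)
  have N_D: "x = 0" if "x \<in> N" "x \<in> D" for x
  proof -
    have "inner x x = 0" using that unfolding N_def by blast
    then show ?thesis by simp
  qed
  have main: "x = 0"
    if "A \<subseteq> {1..k}" "B \<subseteq> {1..k}" "A \<inter> B = {}" "x \<in> N" "x \<in> mixed_part n V A B" for A B x
    using that
  proof (induction "card ({1..k} - (A \<union> B))" arbitrary: A B x rule: less_induct)
    case less
    show ?case
    proof (cases "A \<union> B = {1..k}")
      \<comment> \<open>Every row is decided, so \<open>x\<close> lies in a wandering subspace,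
        hence in both \<open>D\<close> and \<open>N\<close>.\<close>
      case True
      then have "B = {1..k} - A" using less.prems by blast
      then show ?thesis using less.prems D_mixed[of A] N_D by blast
    next
      case False
      then obtain i where i: "i \<in> {1..k}" "i \<notin> A" "i \<notin> B" using less.prems by blast
      have idx: "idx i s" if "s \<in> {1..n i}" for s using that i by (simp add: idx_def)
      have card: "card ({1..k} - (insert i A \<union> B)) < card ({1..k} - (A \<union> B))"
        "card ({1..k} - (A \<union> insert i B)) < card ({1..k} - (A \<union> B))"
        using i by (intro psubset_card_mono; blast)+
      let ?M = "mixed_part n V A B"
      note sub = csubspaceD[OF csubspace_mixed_part[OF less.prems(1,2)]]
      have step: "proj i y = y" if y: "y \<in> N" "y \<in> ?M" for y
      proof -
        have "proj i y \<in> ?M"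
          unfolding range_proj_def using y less.prems i idx
          by (intro sub(5) mixed_part_V mixed_part_adj) auto
        then have "y - proj i y \<in> ?M" using y sub(4) by blast
        moreover have "adj i s (y - proj i y) = 0" if "s \<in> {1..n i}" for s
          using idx[OF that] by (simp add: adj_simps adj_proj)
        ultimately have "y - proj i y \<in> mixed_part n V (insert i A) B"
          by (simp add: mixed_part_iff)
        moreover have "y - proj i y \<in> N"
          unfolding range_proj_def using y idx by (intro N_diff N_sum N_V N_adj) auto
        ultimately have "y - proj i y = 0"
          using less.hyps[OF card(1), of "y - proj i y"] less.prems i by auto
        then show ?thesis by simp
      qed
      \<comment> \<open>Since \<open>i\<close> is outside \<open>A\<close>, the vectors
        \<open>adj i s y\<close> stay in \<open>N\<close> and in the mixed part, where
        \<open>step\<close> applies again.\<close>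
      have "y \<in> level i m" if "y \<in> N" "y \<in> ?M" for y m
        using that
      proof (induction m arbitrary: y)
        case (Suc m)
        have "adj i s y \<in> level i m" if "s \<in> {1..n i}" for s
          using Suc that idx i less.prems(1,2) N_adj mixed_part_adj by blast
        then show ?case using Suc.prems step by simp
      qed simp
      then have "x \<in> mixed_part n V A (insert i B)"
        using less.prems by (auto simp: mixed_part_iff)
      then show ?thesis using less.hyps[OF card(2), of x] less.prems i by auto
    qed
  qed
  show ?thesis
  proof (rule ccontr)
    assume "D \<noteq> UNIV"
    then obtain z where z: "z \<noteq> 0" "z \<in> N"
      using exists_orthogonal_vector[OF D] by (auto simp: N_def)
    \<comment> \<open>With no row decided the mixed part is the whole space.\<close>
    have "z \<in> mixed_part n V {} {}" by (simp add: mixed_part_iff)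
    then show False using main[of "{}" "{}" z] z by simp
  qed
qed

end

section \<open>The wandering subspaces\<close>

lemma subspace_sum_image_iff:
  "x \<in> subspace_sum I (\<lambda>i. F i ` S) \<longleftrightarrow> (\<exists>y. (\<forall>i\<in>I. y i \<in> S) \<and> x = (\<Sum>i\<in>I. F i (y i)))"
proof
  assume "x \<in> subspace_sum I (\<lambda>i. F i ` S)"
  then obtain z where z: "\<forall>i\<in>I. z i \<in> F i ` S" "x = (\<Sum>i\<in>I. z i)"
    by (auto simp: subspace_sum_def)
  then have "\<forall>i\<in>I. \<exists>y. y \<in> S \<and> z i = F i y" by blast
  then obtain y where "\<forall>i\<in>I. y i \<in> S \<and> z i = F i (y i)" by metis
  then show "\<exists>y. (\<forall>i\<in>I. y i \<in> S) \<and> x = (\<Sum>i\<in>I. F i (y i))" using z(2) by auto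
qed (auto simp: subspace_sum_def)

text \<open>Needed because words of length \<open>Suc N\<close>, and families over
  \<open>insert b J\<close>, arise as injective images of products.\<close>

lemma subspace_sum_reindex:
  assumes "inj_on g K"
  shows "subspace_sum (g ` K) (\<lambda>i. F i ` S) = subspace_sum K (\<lambda>j. F (g j) ` S)"
proof (intro set_eqI iffI)
  fix x
  assume "x \<in> subspace_sum (g ` K) (\<lambda>i. F i ` S)"
  then obtain y where "\<forall>i\<in>g ` K. y i \<in> S" "x = (\<Sum>i\<in>g ` K. F i (y i))"
    unfolding subspace_sum_image_iff by blast
  then show "x \<in> subspace_sum K (\<lambda>j. F (g j) ` S)"
    unfolding subspace_sum_image_iff using assms
    by (intro exI[of _ "y \<circ> g"]) (simp add: sum.reindex)
next
  fix x
  assume "x \<in> subspace_sum K (\<lambda>j. F (g j) ` S)"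
  then obtain y where "\<forall>j\<in>K. y j \<in> S" "x = (\<Sum>j\<in>K. F (g j) (y j))"
    unfolding subspace_sum_image_iff by blast
  then show "x \<in> subspace_sum (g ` K) (\<lambda>i. F i ` S)"
    unfolding subspace_sum_image_iff using assms
    by (intro exI[of _ "y \<circ> inv_into K g"]) (simp add: sum.reindex)
qed

text \<open>The recursion step for both words and families of words: the coefficients of a first
  expansion are expanded in turn, and the double sum is flattened.\<close>

lemma subspace_sum_Times:
  assumes "\<And>a. a \<in> I \<Longrightarrow> y a \<in> subspace_sum J (\<lambda>b. F b ` S)"
    and "\<And>a f. a \<in> I \<Longrightarrow> T a (\<Sum>b\<in>J. f b) = (\<Sum>b\<in>J. T a (f b))"
  shows "(\<Sum>a\<in>I. T a (y a)) \<in> subspace_sum (I \<times> J) (\<lambda>p. (T (fst p) \<circ> F (snd p)) ` S)"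
proof -
  have "\<forall>a\<in>I. \<exists>z. (\<forall>b\<in>J. z b \<in> S) \<and> y a = (\<Sum>b\<in>J. F b (z b))"
    using assms(1) unfolding subspace_sum_image_iff by blast
  then obtain z where z: "\<forall>a\<in>I. (\<forall>b\<in>J. z a b \<in> S) \<and> y a = (\<Sum>b\<in>J. F b (z a b))" by metis
  have "(\<Sum>a\<in>I. T a (y a)) = (\<Sum>a\<in>I. \<Sum>b\<in>J. T a (F b (z a b)))"
    using z assms(2) by (intro sum.cong) auto
  also have "\<dots> = (\<Sum>p\<in>I \<times> J. (T (fst p) \<circ> F (snd p)) (z (fst p) (snd p)))"
    by (simp add: sum.cartesian_product case_prod_beta)
  finally show ?thesis
    unfolding subspace_sum_image_iff using z by (intro exI[of _ "\<lambda>p. z (fst p) (snd p)"]) auto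
qed

section \<open>Recursion for words and families of words\<close>

lemma word_op_simps [simp]:
  "word_op W [] x = x" "word_op W (s # w) = W s \<circ> word_op W w"
  by (simp_all add: word_op_def)

lemma words_0: "words m 0 = {[]}"
  by (auto simp: words_def)

lemma words_Suc: "words m (Suc N) = (\<lambda>p. fst p # snd p) ` ({1..m} \<times> words m N)"
proof (intro set_eqI iffI)
  fix w assume "w \<in> words m (Suc N)"
  then obtain s v where "w = s # v" "s \<in> {1..m}" "v \<in> words m N"
    by (auto simp: words_def length_Suc_conv)
  then show "w \<in> (\<lambda>p. fst p # snd p) ` ({1..m} \<times> words m N)"
    by (intro image_eqI[of _ _ "(s, v)"]) auto
qed (auto simp: words_def)

text \<open>An index below all of \<open>J\<close> heads the sorted list, so its operator is
  outermost. Changing the family at \<open>b\<close> does not affect the operators over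
  \<open>J\<close>.\<close>

lemma multiword_op_insert_min:
  assumes "finite J" "\<forall>j\<in>J. b < j"
  shows "multiword_op V (insert b J) (\<alpha>(b := w)) = word_op (V b) w \<circ> multiword_op V J \<alpha>"
proof -
  have b: "b \<notin> J" using assms(2) by blast
  have "sorted_list_of_set (insert b J) = b # sorted_list_of_set J"
    using assms b by (simp add: insort_is_Cons less_imp_le)
  moreover have "foldr (\<lambda>j T. word_op (V j) ((\<alpha>(b := w)) j) \<circ> T) (sorted_list_of_set J) id =
      foldr (\<lambda>j T. word_op (V j) (\<alpha> j) \<circ> T) (sorted_list_of_set J) id"
    using assms(1) b by (intro foldr_cong) auto
  ultimately show ?thesis by (simp add: multiword_op_def)
qed

section \<open>Expansion of vectors over words\<close>

context doubly_commuting_rows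
begin

lemma word_op_mem:
  assumes "j \<in> {1..k}" "set w \<subseteq> {1..n j}" "x \<in> S"
    and "\<And>t x. idx j t \<Longrightarrow> x \<in> S \<Longrightarrow> V j t x \<in> S"
  shows "word_op (V j) w x \<in> S"
  using assms(2)
proof (induction w)
  case (Cons t w)
  then have "idx j t" "word_op (V j) w x \<in> S" using assms(1) by (auto simp: idx_def)
  then show ?case using assms(4) by simp
qed (simp add: assms(3))

lemma word_op_level:
  assumes "j \<in> {1..k}" "set w \<subseteq> {1..n j}"
  shows "word_op (V j) w x \<in> level j (length w)"
  using assms(2)
proof (induction w)
  case (Cons s w)
  then have "idx j s" "word_op (V j) w x \<in> level j (length w)" using assms(1) by (auto simp: idx_def)
  then show ?case using level_V_Suc by simp
qed simp

lemma word_op_sum: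
  assumes "j \<in> {1..k}" "set w \<subseteq> {1..n j}"
  shows "word_op (V j) w (\<Sum>i\<in>I. f i) = (\<Sum>i\<in>I. word_op (V j) w (f i))"
  using assms(2)
proof (induction w)
  case (Cons s w)
  then have "idx j s" using assms(1) by (simp add: idx_def)
  then show ?case using Cons by (simp add: V_simps)
qed simp

text \<open>On \<open>S\<close> the identity is the sum of the \<open>V j s\<close> after their
  adjoints. Iterating this \<open>N\<close> times expands \<open>x\<close> over words of length
  \<open>N\<close>, with coefficients that remain in \<open>S\<close>.\<close>

lemma subspace_sum_words:
  assumes j: "j \<in> {1..k}"
    and S: "\<And>x. x \<in> S \<Longrightarrow> proj j x = x" "\<And>t x. x \<in> S \<Longrightarrow> idx j t \<Longrightarrow> adj j t x \<in> S"
  shows "x \<in> S \<Longrightarrow> x \<in> subspace_sum (words (n j) N) (\<lambda>w. word_op (V j) w ` S)"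
proof (induction N arbitrary: x)
  case 0
  then show ?case
    unfolding words_0 subspace_sum_image_iff by (intro exI[of _ "\<lambda>_. x"]) simp
next
  case (Suc N)
  have idx: "idx j s" if "s \<in> {1..n j}" for s using that j by (simp add: idx_def)
  have "x = (\<Sum>s\<in>{1..n j}. V j s (adj j s x))"
    using S(1)[OF Suc.prems] by (simp add: range_proj_def)
  also have "\<dots> \<in> subspace_sum ({1..n j} \<times> words (n j) N)
      (\<lambda>p. (V j (fst p) \<circ> word_op (V j) (snd p)) ` S)"
    using Suc S idx by (intro subspace_sum_Times) (auto simp: V_simps)
  also have "\<dots> = subspace_sum (words (n j) (Suc N)) (\<lambda>w. word_op (V j) w ` S)"
    unfolding words_Suc by (subst subspace_sum_reindex) (auto simp: inj_on_def)
  finally show ?case .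
qed

text \<open>The rows are expanded one at a time, the smallest index first, to match the order of
  composition in \<open>multiword_op\<close>.\<close>

lemma subspace_sum_multiwords:
  assumes "J \<subseteq> {1..k}"
    and S: "\<And>j x. j \<in> J \<Longrightarrow> x \<in> S \<Longrightarrow> proj j x = x"
      "\<And>j t x. j \<in> J \<Longrightarrow> x \<in> S \<Longrightarrow> idx j t \<Longrightarrow> adj j t x \<in> S"
    and "x \<in> S"
  shows "x \<in> subspace_sum (\<Pi>\<^sub>E j\<in>J. words (n j) (m j)) (\<lambda>\<alpha>. multiword_op V J \<alpha> ` S)"
proof -
  have "finite J" using assms(1) by (rule finite_subset) simp
  then show ?thesis
    using assms
  proof (induction J arbitrary: x rule: finite_linorder_min_induct)
    case empty
    then show ?case
      unfolding subspace_sum_image_iff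
      by (intro exI[of _ "\<lambda>_. x"]) (simp add: multiword_op_def)
  next
    case (insert b J)
    let ?P = "\<lambda>J. \<Pi>\<^sub>E j\<in>J. words (n j) (m j)"
    have b: "b \<notin> J" "b \<in> {1..k}" using insert.hyps insert.prems(1) by auto
    have "x \<in> subspace_sum (words (n b) (m b)) (\<lambda>w. word_op (V b) w ` S)"
      using insert.prems b by (intro subspace_sum_words) auto
    then obtain y where y: "\<forall>w\<in>words (n b) (m b). y w \<in> S"
      and x: "x = (\<Sum>w\<in>words (n b) (m b). word_op (V b) w (y w))"
      unfolding subspace_sum_image_iff by blast
    have "y w \<in> subspace_sum (?P J) (\<lambda>\<alpha>. multiword_op V J \<alpha> ` S)" if "w \<in> words (n b) (m b)" for w
      using insert.prems y that by (intro insert.IH) auto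
    then have "x \<in> subspace_sum (words (n b) (m b) \<times> ?P J)
        (\<lambda>p. (word_op (V b) (fst p) \<circ> multiword_op V J (snd p)) ` S)"
      unfolding x using b by (intro subspace_sum_Times word_op_sum) (auto simp: words_def)
    also have "\<dots> = subspace_sum (words (n b) (m b) \<times> ?P J)
        (\<lambda>p. multiword_op V (insert b J) ((snd p)(b := fst p)) ` S)"
      using insert.hyps by (simp add: multiword_op_insert_min)
    also have "\<dots> = subspace_sum ((\<lambda>p. (snd p)(b := fst p)) ` (words (n b) (m b) \<times> ?P J))
        (\<lambda>\<alpha>. multiword_op V (insert b J) \<alpha> ` S)"
      using inj_combinator[OF b(1), of "\<lambda>j. words (n j) (m j)"]
      by (subst subspace_sum_reindex) (simp_all add: case_prod_beta')
    also have "(\<lambda>p. (snd p)(b := fst p)) ` (words (n b) (m b) \<times> ?P J) = ?P (insert b J)"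
      by (simp add: PiE_insert_eq case_prod_beta')
    finally show ?case .
  qed
qed

text \<open>Replaces the sums over words by conditions on adjoints alone. One inclusion is the
  expansion over words; the other evaluates the intersection at constant length functions
  \<open>m\<close>.\<close>

lemma wandering_subspace_eq_mixed_part:
  assumes A: "A \<subseteq> {1..k}"
  shows "wandering_subspace k n V A = mixed_part n V A ({1..k} - A)"
proof -
  define J where "J = {1..k} - A"
  have J: "J \<subseteq> {1..k}" "finite J" by (auto simp: J_def)
  let ?P = "\<lambda>m. \<Pi>\<^sub>E j\<in>J. words (n j) (m j)"
  let ?S = "\<lambda>m. subspace_sum (?P m) (\<lambda>\<alpha>. multiword_op V J \<alpha> ` joint_kernel n V A)"
  have "x \<in> ?S m" if x: "x \<in> mixed_part n V A J" for x m
  proof -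
    have "proj j y = y" if "j \<in> J" "y \<in> mixed_part n V A J" for j y
    proof -
      have "y \<in> level j (Suc 0)" using that unfolding mixed_part_def by blast
      then show ?thesis by simp
    qed
    \<comment> \<open>The expansion takes place in the mixed part, where \<open>proj j\<close> acts
      as the identity; the coefficients are weakened to the joint kernel only afterwards.\<close>
    then have "x \<in> subspace_sum (?P m) (\<lambda>\<alpha>. multiword_op V J \<alpha> ` mixed_part n V A J)"
      using A x J by (intro subspace_sum_multiwords mixed_part_adj) (auto simp: J_def)
    then show ?thesis unfolding subspace_sum_image_iff mixed_part_def by blast
  qed
  moreover have "x \<in> mixed_part n V A J" if x: "\<And>m. x \<in> ?S m" for x
    unfolding mixed_part_def
  proof (intro IntI INT_I)
    \<comment> \<open>Arbitrary lists replace the sorted list of \<open>J\<close>, to allow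
      induction on the list.\<close>
    define F where "F \<alpha> js = foldr (\<lambda>j T. word_op (V j) (\<alpha> j) \<circ> T) js id"
      for \<alpha> :: "nat \<Rightarrow> nat list" and js
    have F_simps: "F \<alpha> [] y = y" "F \<alpha> (j # js) y = word_op (V j) (\<alpha> j) (F \<alpha> js y)" for \<alpha> j js y
      by (simp_all add: F_def)
    have multiword: "multiword_op V J \<alpha> = F \<alpha> (sorted_list_of_set J)" for \<alpha>
      by (simp add: F_def multiword_op_def)
    have ker: "F \<alpha> js y \<in> joint_kernel n V A"
      if "set js \<subseteq> J" "\<forall>j\<in>J. set (\<alpha> j) \<subseteq> {1..n j}" "y \<in> joint_kernel n V A" for js \<alpha> y
      using that
    proof (induction js)
      case (Cons j js)
      then have j: "j \<in> {1..k}" "j \<notin> A" "set (\<alpha> j) \<subseteq> {1..n j}" by (auto simp: J_def)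
      have "F \<alpha> js y \<in> joint_kernel n V A" by (rule Cons.IH) (use Cons.prems in auto)
      then show ?case
        unfolding F_simps using joint_kernel_V[OF A _ j(2)] by (intro word_op_mem j(1,3)) auto
    qed (simp add: F_simps)
    \<comment> \<open>The word of row \<open>i\<close> produces the level, and the words of other
      rows composed outside it preserve that level.\<close>
    have lev: "F \<alpha> js y \<in> level i (length (\<alpha> i))"
      if "i \<in> set js" "set js \<subseteq> J" "\<forall>j\<in>J. set (\<alpha> j) \<subseteq> {1..n j}" for js \<alpha> y i
      using that
    proof (induction js)
      case (Cons j js)
      then have j: "j \<in> {1..k}" "set (\<alpha> j) \<subseteq> {1..n j}" and i: "i \<in> {1..k}" using J by auto
      show ?case
      proof (cases "i = j")
        case True
        then show ?thesis unfolding F_simps using word_op_level[OF j] by simp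
      next
        case False
        then have "F \<alpha> js y \<in> level i (length (\<alpha> i))" by (intro Cons.IH) (use Cons.prems in auto)
        then show ?thesis
          unfolding F_simps using level_V[OF _ i False] by (intro word_op_mem j) auto
      qed
    qed simp
    have set_J: "set (sorted_list_of_set J) = J" using J(2) by simp
    have dec: "\<exists>y. (\<forall>\<alpha>\<in>?P m. y \<alpha> \<in> joint_kernel n V A) \<and> x = (\<Sum>\<alpha>\<in>?P m. multiword_op V J \<alpha> (y \<alpha>))"
      for m
      using x[of m] unfolding subspace_sum_image_iff .
    have P: "set (\<alpha> j) \<subseteq> {1..n j}" "length (\<alpha> j) = m j" if "\<alpha> \<in> ?P m" "j \<in> J" for \<alpha> j m
      using PiE_mem[OF that] by (auto simp: words_def)
    show "x \<in> joint_kernel n V A"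
    proof -
      \<comment> \<open>Any lengths would serve here, since \<open>ker\<close> applies to words of
        every length.\<close>
      obtain y where y: "\<forall>\<alpha>\<in>?P (\<lambda>_. 0). y \<alpha> \<in> joint_kernel n V A"
        "x = (\<Sum>\<alpha>\<in>?P (\<lambda>_. 0). multiword_op V J \<alpha> (y \<alpha>))"
        using dec[of "\<lambda>_. 0"] by blast
      show ?thesis
        unfolding y(2) multiword using y(1) P
        by (intro csubspaceD(5)[OF csubspace_joint_kernel[OF A]] ker) (auto simp: set_J)
    qed
    show "x \<in> level j N" if j: "j \<in> J" for j N
    proof -
      \<comment> \<open>With all lengths equal to \<open>N\<close>, every summand contains a word of
        length \<open>N\<close> in row \<open>j\<close>.\<close>
      obtain y where y: "\<forall>\<alpha>\<in>?P (\<lambda>_. N). y \<alpha> \<in> joint_kernel n V A"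
        "x = (\<Sum>\<alpha>\<in>?P (\<lambda>_. N). multiword_op V J \<alpha> (y \<alpha>))"
        using dec[of "\<lambda>_. N"] by blast
      have "multiword_op V J \<alpha> (y \<alpha>) \<in> level j N" if \<alpha>: "\<alpha> \<in> ?P (\<lambda>_. N)" for \<alpha>
        using lev[of j "sorted_list_of_set J" \<alpha> "y \<alpha>"] P(1)[OF \<alpha>] P(2)[OF \<alpha> j] j
        by (simp add: set_J multiword)
      then show ?thesis
        unfolding y(2) using j J by (intro csubspaceD(5)[OF csubspace_level]) auto
    qed
  qed
  ultimately show ?thesis unfolding wandering_subspace_def Let_def J_def by blast
qed

end

section \<open>Unitary equivalence\<close>

lemma unitary_betweenD:
  assumes "unitary_between S T u"
  shows "x \<in> S \<Longrightarrow> y \<in> S \<Longrightarrow> u (x + y) = u x + u y" "x \<in> S \<Longrightarrow> u (c *\<^sub>C x) = c *\<^sub>C u x"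
    "x \<in> S \<Longrightarrow> y \<in> S \<Longrightarrow> cinner (u x) (u y) = cinner x y" "bij_betw u S T"
  using assms by (auto simp: unitary_between_def)

lemma in_fst_image_iff: "x \<in> fst ` G \<longleftrightarrow> (\<exists>y. (x, y) \<in> G)"
  by force

lemma in_snd_image_iff: "y \<in> snd ` G \<longleftrightarrow> (\<exists>x. (x, y) \<in> G)"
  by force

text \<open>Applied to differences of pairs, equality of norms makes the relation single-valued and
  injective. Polarization then gives the real inner product, and multiplication by
  \<open>\<i>\<close> its imaginary companion.\<close>

lemma unitary_of_graph:
  fixes G :: "('a::complex_hilbert_space \<times> 'b::complex_hilbert_space) set"
  assumes add: "\<And>x y x' y'. (x, y) \<in> G \<Longrightarrow> (x', y') \<in> G \<Longrightarrow> (x + x', y + y') \<in> G"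
    and scale: "\<And>c x y. (x, y) \<in> G \<Longrightarrow> (c *\<^sub>C x, c *\<^sub>C y) \<in> G"
    and isometric: "\<And>x y. (x, y) \<in> G \<Longrightarrow> norm x = norm y"
    and total: "fst ` G = UNIV" "snd ` G = UNIV"
  shows "\<exists>U. unitary_between UNIV UNIV U \<and> (\<forall>x. (x, U x) \<in> G)"
proof -
  have diff: "(x - x', y - y') \<in> G" if "(x, y) \<in> G" "(x', y') \<in> G" for x y x' y'
    using add[OF that(1) scale[OF that(2), of "- 1"]] by (simp add: scaleC_minus_one)
  have "\<exists>y. (x, y) \<in> G" for x
    using total(1) unfolding in_fst_image_iff[symmetric] by simp
  then obtain U where U: "\<And>x. (x, U x) \<in> G" by metis
  have unique: "U x = y" if "(x, y) \<in> G" for x y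
    using isometric[OF diff[OF U[of x] that]] by simp
  have U_add: "U (x + y) = U x + U y" for x y using unique[OF add[OF U U]] .
  have U_scale: "U (c *\<^sub>C x) = c *\<^sub>C U x" for c x using unique[OF scale[OF U]] .
  have norm_U: "norm (U x) = norm x" for x using isometric[OF U] by simp
  have inner_U: "inner (U x) (U y) = inner x y" for x y
    unfolding dot_norm by (simp add: norm_U flip: U_add)
  have "cinner (U x) (U y) = cinner x y" for x y
    by (rule complex_eqI) (simp_all add: Im_cinner inner_U flip: inner_eq_Re_cinner U_scale)
  moreover have "inj U"
  proof (rule injI)
    fix x y assume "U x = U y"
    then show "x = y" using isometric[OF diff[OF U U], of x y] by simp
  qed
  moreover have "surj U"
    unfolding surj_def
  proof
    fix y
    obtain x where "(x, y) \<in> G" using total(2) in_snd_image_iff[of y G] by auto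
    then show "\<exists>x. y = U x" using unique by blast
  qed
  ultimately have "unitary_between UNIV UNIV U"
    by (simp add: unitary_between_def U_add U_scale bij_def)
  then show ?thesis using U by blast
qed

text \<open>If the first coordinates of a sequence of pairs converge, isometry makes the second
  coordinates Cauchy, so the pairs converge inside \<open>G\<close>.\<close>

lemma closed_fst_image_isometric:
  fixes G :: "('a::complete_space \<times> 'b::complete_space) set"
  assumes "closed G"
    and isometric: "\<And>x y x' y'. (x, y) \<in> G \<Longrightarrow> (x', y') \<in> G \<Longrightarrow> dist y y' = dist x x'"
  shows "closed (fst ` G)"
  unfolding closed_sequential_limits
proof (intro allI impI, elim conjE)
  fix X l
  assume X: "\<forall>n. X n \<in> fst ` G" and lim: "X \<longlonglongrightarrow> l"
  have "\<forall>n. \<exists>y. (X n, y) \<in> G" using X unfolding in_fst_image_iff .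
  then obtain Y where Y: "\<And>n. (X n, Y n) \<in> G" by metis
  have "Cauchy X" using lim by (rule LIMSEQ_imp_Cauchy)
  then have "Cauchy Y" unfolding Cauchy_def isometric[OF Y Y] .
  then obtain m where "Y \<longlonglongrightarrow> m" using Cauchy_convergent convergent_def by blast
  with lim have "(\<lambda>n. (X n, Y n)) \<longlonglongrightarrow> (l, m)" by (rule tendsto_Pair)
  then have "(l, m) \<in> G" using closed_sequentially[OF assms(1), of "\<lambda>n. (X n, Y n)"] Y by blast
  then show "l \<in> fst ` G" by force
qed

lemma closed_snd_image_isometric:
  fixes G :: "('a::complete_space \<times> 'b::complete_space) set"
  assumes "closed G"
    and isometric: "\<And>x y x' y'. (x, y) \<in> G \<Longrightarrow> (x', y') \<in> G \<Longrightarrow> dist y y' = dist x x'"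
  shows "closed (snd ` G)"
proof -
  have "closed ((\<lambda>p. (snd p, fst p)) -` G)"
    using assms(1) by (intro closed_vimage continuous_intros)
  then have "closed (fst ` ((\<lambda>p. (snd p, fst p)) -` G))"
    by (rule closed_fst_image_isometric) (use isometric in force)
  also have "(\<lambda>p. (snd p, fst p)) -` G = (\<lambda>p. (snd p, fst p)) ` G" by force
  also have "fst ` \<dots> = snd ` G" by (simp add: image_image)
  finally show ?thesis .
qed

text \<open>The inductive form gives one proof case per closure condition. Invariance under adjoints
  is not built in and has to be derived for the generators at hand.\<close>

inductive_set intertwining_span ::
    "nat \<Rightarrow> (nat \<Rightarrow> nat) \<Rightarrow> (nat \<Rightarrow> nat \<Rightarrow> 'a::complex_hilbert_space \<Rightarrow> 'a) \<Rightarrow>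
      (nat \<Rightarrow> nat \<Rightarrow> 'b::complex_hilbert_space \<Rightarrow> 'b) \<Rightarrow> ('a \<times> 'b) set \<Rightarrow> ('a \<times> 'b) set"
  for k n V V' B
  where
    base: "(x, y) \<in> B \<Longrightarrow> (x, y) \<in> intertwining_span k n V V' B"
  | add: "(x, y) \<in> intertwining_span k n V V' B \<Longrightarrow> (x', y') \<in> intertwining_span k n V V' B \<Longrightarrow>
      (x + x', y + y') \<in> intertwining_span k n V V' B"
  | scale: "(x, y) \<in> intertwining_span k n V V' B \<Longrightarrow>
      (c *\<^sub>C x, c *\<^sub>C y) \<in> intertwining_span k n V V' B"
  | apply_op: "(x, y) \<in> intertwining_span k n V V' B \<Longrightarrow> i \<in> {1..k} \<Longrightarrow> s \<in> {1..n i} \<Longrightarrow>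
      (V i s x, V' i s y) \<in> intertwining_span k n V V' B"

section \<open>From the tuples to their wandering data\<close>

locale doubly_commuting_pair =
  V: doubly_commuting_rows k n lam V + V': doubly_commuting_rows k n lam V'
  for k :: nat and n :: "nat \<Rightarrow> nat" and lam :: "nat \<Rightarrow> nat \<Rightarrow> nat \<Rightarrow> nat \<Rightarrow> complex"
    and V :: "nat \<Rightarrow> nat \<Rightarrow> 'a::complex_hilbert_space \<Rightarrow> 'a"
    and V' :: "nat \<Rightarrow> nat \<Rightarrow> 'b::complex_hilbert_space \<Rightarrow> 'b"
begin

abbreviation wandering :: "nat set \<Rightarrow> 'a set"
  where "wandering A \<equiv> mixed_part n V A ({1..k} - A)"

abbreviation wandering' :: "nat set \<Rightarrow> 'b set"
  where "wandering' A \<equiv> mixed_part n V' A ({1..k} - A)"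

abbreviation idx :: "nat \<Rightarrow> nat \<Rightarrow> bool"
  where "idx \<equiv> V.idx"

text \<open>The restrictions of the operators may be dropped because the unitary maps into the
  second wandering subspace.\<close>

lemma wandering_data_equivalent_iff:
  assumes "A \<subseteq> {1..k}"
  shows "wandering_data_equivalent k n A (wandering_data k n V A) (wandering_data k n V' A) \<longleftrightarrow>
    (\<exists>\<phi>. unitary_between (wandering A) (wandering' A) \<phi> \<and>
      (\<forall>j\<in>{1..k} - A. \<forall>t\<in>{1..n j}. \<forall>x\<in>wandering A. \<phi> (V j t x) = V' j t (\<phi> x)))"
proof -
  have "\<phi> x \<in> wandering' A" if "unitary_between (wandering A) (wandering' A) \<phi>" "x \<in> wandering A"
    for \<phi> x
    using unitary_betweenD(4)[OF that(1)] that(2) by (auto simp: bij_betw_def)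
  then show ?thesis
    unfolding wandering_data_equivalent_def wandering_data_def fst_conv snd_conv
      V.wandering_subspace_eq_mixed_part[OF assms] V'.wandering_subspace_eq_mixed_part[OF assms]
    by (intro ex_cong1 conj_cong refl) auto
qed

text \<open>Surjectivity allows test vectors of the form \<open>U z\<close>, against which both
  sides reduce to \<open>cinner (V i s z) x\<close>.\<close>

lemma unitary_intertwines_adjoint:
  assumes U: "unitary_between UNIV UNIV U" and inter: "\<And>x. U (V i s x) = V' i s (U x)"
    and i: "idx i s"
  shows "U (V.adj i s x) = V'.adj i s (U x)"
proof (rule cinner_eqI)
  fix y
  obtain z where z: "y = U z" using unitary_betweenD(4)[OF U] by (metis bij_betw_def UNIV_I imageE)
  show "cinner y (U (V.adj i s x)) = cinner y (V'.adj i s (U x))"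
    using i unitary_betweenD(3)[OF U]
    by (simp add: z flip: V.cinner_adj V'.cinner_adj inter)
qed

text \<open>A mixed part is described by adjoints and range projections, all of which
  \<open>U\<close> intertwines; injectivity turns each condition into an equivalence.\<close>

lemma unitary_image_wandering:
  assumes U: "unitary_between UNIV UNIV U" and A: "A \<subseteq> {1..k}"
    and inter: "\<And>i s x. idx i s \<Longrightarrow> U (V i s x) = V' i s (U x)"
  shows "U ` wandering A = wandering' A"
proof -
  note bij = unitary_betweenD(4)[OF U]
  have adj: "U (V.adj i s x) = V'.adj i s (U x)" if "i \<in> {1..k}" "s \<in> {1..n i}" for i s x
    using unitary_intertwines_adjoint[OF U inter] that by (simp add: V.idx_def)
  have op: "U (V i s x) = V' i s (U x)" if "i \<in> {1..k}" "s \<in> {1..n i}" for i s x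
    using inter that by (simp add: V.idx_def)
  have U0: "U 0 = 0" using unitary_betweenD(2)[OF U, of 0 0] by simp
  have inj: "U x = U y \<longleftrightarrow> x = y" for x y using bij by (auto simp: bij_betw_def inj_on_def)
  have U_sum: "U (\<Sum>i\<in>I. f i) = (\<Sum>i\<in>I. U (f i))" for I and f :: "nat \<Rightarrow> 'a"
    by (induction I rule: infinite_finite_induct) (simp_all add: U0 unitary_betweenD(1)[OF U])
  have proj: "U (V.proj i x) = V'.proj i (U x)" if "i \<in> {1..k}" for i x
    unfolding range_proj_def U_sum using that by (intro sum.cong) (simp_all add: adj op)
  have level: "U x \<in> V'.level i N \<longleftrightarrow> x \<in> V.level i N" if "i \<in> {1..k}" for i N x
  proof (induction N arbitrary: x)
    case (Suc N)
    show ?case using that by (simp add: Suc inj flip: adj proj)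
  qed simp
  have zero: "V'.adj i s (U x) = 0 \<longleftrightarrow> V.adj i s x = 0" if "i \<in> A" "s \<in> {1..n i}" for i s x
    using adj[of i s x] inj[of "V.adj i s x" 0] A that by (auto simp: U0)
  have "U x \<in> wandering' A \<longleftrightarrow> x \<in> wandering A" for x
    unfolding mixed_part_iff using zero level by auto
  then show ?thesis using bij by (auto simp: bij_betw_def image_iff) (metis UNIV_I imageE)
qed

end

text \<open>The adjoints preserve the span of the vectors \<open>V\<^sub>\<beta> x\<close> with \<open>x\<close> in a wandering subspace, so
  that inner products in that span can be computed by moving the operators to the other side until
  both vectors lie in wandering subspaces.  This only uses relations common to \<open>V\<close> and \<open>V'\<close>.\<close>

locale equivalent_wandering_data = doubly_commuting_pair k n lam V V'
  for k :: nat and n :: "nat \<Rightarrow> nat" and lam :: "nat \<Rightarrow> nat \<Rightarrow> nat \<Rightarrow> nat \<Rightarrow> complex"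
    and V :: "nat \<Rightarrow> nat \<Rightarrow> 'a::complex_hilbert_space \<Rightarrow> 'a"
    and V' :: "nat \<Rightarrow> nat \<Rightarrow> 'b::complex_hilbert_space \<Rightarrow> 'b" +
  fixes \<phi> :: "nat set \<Rightarrow> 'a \<Rightarrow> 'b"
  assumes unitary: "A \<subseteq> {1..k} \<Longrightarrow> unitary_between (wandering A) (wandering' A) (\<phi> A)"
    and intertwines: "A \<subseteq> {1..k} \<Longrightarrow> idx j t \<Longrightarrow> j \<notin> A \<Longrightarrow> x \<in> wandering A \<Longrightarrow>
      \<phi> A (V j t x) = V' j t (\<phi> A x)"
begin

section \<open>The graph generated by equivalences of wandering data\<close>

lemma phi_image: "A \<subseteq> {1..k} \<Longrightarrow> \<phi> A ` wandering A = wandering' A"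
  using unitary_betweenD(4)[OF unitary] by (simp add: bij_betw_def)

lemma phi_mem: "A \<subseteq> {1..k} \<Longrightarrow> x \<in> wandering A \<Longrightarrow> \<phi> A x \<in> wandering' A"
  using phi_image by blast

text \<open>Test vectors are confined to \<open>wandering' A\<close>, but the difference of the two
  sides lies there itself. Written as \<open>\<phi> A y\<close>, it turns out to be orthogonal to
  itself.\<close>

lemma phi_adj:
  assumes A: "A \<subseteq> {1..k}" and j: "idx j t" "j \<notin> A" and x: "x \<in> wandering A"
  shows "\<phi> A (V.adj j t x) = V'.adj j t (\<phi> A x)"
proof -
  have J: "{1..k} - A \<subseteq> {1..k}" by blast
  let ?z = "\<phi> A (V.adj j t x) - V'.adj j t (\<phi> A x)"
  have Vx: "V.adj j t x \<in> wandering A" by (rule V.mixed_part_adj[OF A J j x])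
  have "?z \<in> wandering' A"
    using phi_mem[OF A] Vx V'.mixed_part_adj[OF A J j phi_mem[OF A x]]
      csubspaceD(4)[OF V'.csubspace_mixed_part[OF A J]] by blast
  then obtain y where y: "y \<in> wandering A" "?z = \<phi> A y" using phi_image[OF A] by blast
  note iso = unitary_betweenD(3)[OF unitary[OF A]]
  have "cinner (\<phi> A (V.adj j t x)) (\<phi> A y) = cinner x (V j t y)"
    using iso Vx y j by (simp add: V.cinner_adj_left)
  also have "\<dots> = cinner (\<phi> A x) (\<phi> A (V j t y))"
    using iso x V.mixed_part_V[OF A J j y(1)] by simp
  also have "\<dots> = cinner (V'.adj j t (\<phi> A x)) (\<phi> A y)"
    using intertwines[OF A j y(1)] j by (simp add: V'.cinner_adj_left)
  finally have "cinner ?z ?z = 0" by (simp only: y(2)[symmetric] cinner_diff_left) (simp add: y(2))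
  then show ?thesis using cinner_self_eq_0D by fastforce
qed

definition generators :: "('a \<times> 'b) set"
  where "generators = {(x, \<phi> A x) | A x. A \<subseteq> {1..k} \<and> x \<in> wandering A}"

abbreviation graph :: "('a \<times> 'b) set"
  where "graph \<equiv> intertwining_span k n V V' generators"

lemma generator: "A \<subseteq> {1..k} \<Longrightarrow> x \<in> wandering A \<Longrightarrow> (x, \<phi> A x) \<in> graph"
  by (rule intertwining_span.base) (auto simp: generators_def)

lemma zero_in_graph: "(0, 0) \<in> graph"
proof -
  have "0 \<in> wandering {}" using csubspaceD(1)[OF V.csubspace_mixed_part] by simp
  then show ?thesis using intertwining_span.scale[OF generator[of "{}" 0], of 0] by simp
qed

lemma graph_op: "(x, y) \<in> graph \<Longrightarrow> idx i s \<Longrightarrow> (V i s x, V' i s y) \<in> graph"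
  by (auto simp: V.idx_def intro: intertwining_span.apply_op)

text \<open>On a generator the adjoint gives zero in both coordinates or another generator. On an
  image under an operator it cancels that operator, gives zero, or passes it with a scalar that is
  the same for both tuples.\<close>

lemma graph_adj:
  assumes "(x, y) \<in> graph" "idx i s"
  shows "(V.adj i s x, V'.adj i s y) \<in> graph"
  using assms(1)
proof (induction rule: intertwining_span.induct)
  case (base x y)
  then obtain A where A: "A \<subseteq> {1..k}" "x \<in> wandering A" "y = \<phi> A x"
    by (auto simp: generators_def)
  show ?case
  proof (cases "i \<in> A")
    case True
    then have "V.adj i s x = 0" "V'.adj i s y = 0"
      using A phi_mem[OF A(1,2)] assms(2) by (auto simp: mixed_part_iff V.idx_def)
    then show ?thesis using zero_in_graph by simp
  next
    case False
    then show ?thesis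
      using A assms(2) generator[OF A(1) V.mixed_part_adj[OF A(1) _ assms(2)]]
      by (simp add: phi_adj)
  qed
next
  case (add x y x' y')
  then show ?case
    using assms(2) by (simp add: V.adj_simps V'.adj_simps intertwining_span.add)
next
  case (scale x y c)
  then show ?case
    using assms(2) by (simp add: V.adj_simps V'.adj_simps intertwining_span.scale)
next
  case (apply_op x y j t)
  then have j: "idx j t" by (simp add: V.idx_def)
  show ?case
  proof (cases "i = j")
    case True
    then show ?thesis
      using apply_op j assms(2) zero_in_graph by (simp add: V.adj_V_same V'.adj_V_same)
  next
    case False
    then show ?thesis
      using apply_op j assms(2)
      by (simp add: V.adj_V_diff V'.adj_V_diff intertwining_span.scale graph_op)
  qed
qed

text \<open>Row \<open>i\<close> has adjoints vanishing on \<open>x\<close>, whereas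
  \<open>y\<close> is a sum of vectors in its ranges. The tuple \<open>W\<close> is arbitrary so
  that both \<open>V\<close> and \<open>V'\<close> are covered.\<close>

lemma wandering_orthogonal:
  assumes "doubly_commuting_rows k n lam W" "i \<in> {1..k}" "i \<in> A" "i \<notin> B"
    and "x \<in> mixed_part n W A ({1..k} - A)" "y \<in> mixed_part n W B ({1..k} - B)"
  shows "cinner x y = 0"
proof -
  interpret W: doubly_commuting_rows k n lam W by fact
  have "y \<in> W.level i (Suc 0)" using assms unfolding mixed_part_iff by blast
  then have y: "y = (\<Sum>s\<in>{1..n i}. W i s (W.adj i s y))" by (simp add: range_proj_def)
  have "cinner x (W i s (W.adj i s y)) = 0" if "s \<in> {1..n i}" for s
    using assms that by (simp add: mixed_part_iff W.idx_def flip: W.cinner_adj_left)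
  then show ?thesis by (subst y) (simp add: cinner_sum_right)
qed

lemma wandering_orthogonal':
  assumes "doubly_commuting_rows k n lam W" "A \<subseteq> {1..k}" "B \<subseteq> {1..k}" "A \<noteq> B"
    and "x \<in> mixed_part n W A ({1..k} - A)" "y \<in> mixed_part n W B ({1..k} - B)"
  shows "cinner x y = 0"
proof -
  obtain i where "i \<in> {1..k}" "i \<in> A \<and> i \<notin> B \<or> i \<in> B \<and> i \<notin> A" using assms by blast
  then show ?thesis
    using wandering_orthogonal[OF assms(1)] assms(5,6) cinner_commute[of x y] by fastforce
qed

text \<open>Induction on the second pair with \<open>x\<close> arbitrary: an operator there becomes
  an adjoint on \<open>x\<close>, which either kills \<open>x\<close> or keeps it in the same
  wandering subspace.\<close>

lemma generator_graph_isometric: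
  assumes "(x', y') \<in> graph" "A \<subseteq> {1..k}" "x \<in> wandering A"
  shows "cinner x x' = cinner (\<phi> A x) y'"
  using assms(1,3)
proof (induction arbitrary: x rule: intertwining_span.induct)
  case (base x' y')
  then obtain B where B: "B \<subseteq> {1..k}" "x' \<in> wandering B" "y' = \<phi> B x'"
    by (auto simp: generators_def)
  show ?case
  proof (cases "A = B")
    case True
    then show ?thesis using B base unitary_betweenD(3)[OF unitary] by simp
  next
    case False
    then show ?thesis
      using wandering_orthogonal'[OF V.doubly_commuting_rows_axioms assms(2) B(1) False base.prems B(2)]
        wandering_orthogonal'[OF V'.doubly_commuting_rows_axioms assms(2) B(1) False
          phi_mem[OF assms(2) base.prems] phi_mem[OF B(1,2)]] B(3)
      by simp
  qed
next
  case (apply_op x' y' j t)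
  then have j: "idx j t" by (simp add: V.idx_def)
  show ?case
  proof (cases "j \<in> A")
    case True
    then have "V.adj j t x = 0" "V'.adj j t (\<phi> A x) = 0"
      using apply_op.prems phi_mem[OF assms(2) apply_op.prems] j
      by (auto simp: mixed_part_iff V.idx_def)
    then show ?thesis using j by (simp flip: V.cinner_adj_left V'.cinner_adj_left)
  next
    case False
    have "cinner (V.adj j t x) x' = cinner (\<phi> A (V.adj j t x)) y'"
      by (intro apply_op.IH V.mixed_part_adj assms(2) j False apply_op.prems) blast
    then show ?thesis
      using phi_adj[OF assms(2) j False apply_op.prems] j
      by (simp flip: V.cinner_adj_left V'.cinner_adj_left)
  qed
qed (simp_all add: cinner_add_right cinner_scaleC_right)

text \<open>Induction on the first pair, down to a generator, with the second pair arbitrary: the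
  adjoints now act on the second pair and stay in \<open>graph\<close> by
  \<open>graph_adj\<close>.\<close>

lemma graph_isometric:
  assumes "(x, y) \<in> graph" "(x', y') \<in> graph"
  shows "cinner x x' = cinner y y'"
  using assms
proof (induction arbitrary: x' y' rule: intertwining_span.induct)
  case (base x y)
  then show ?case using generator_graph_isometric by (auto simp: generators_def)
next
  case (apply_op x y i s)
  then have "idx i s" by (simp add: V.idx_def)
  then show ?case
    using apply_op.IH graph_adj[OF apply_op.prems] by (simp add: V.cinner_adj V'.cinner_adj)
qed (simp_all add: cinner_add_left cinner_scaleC_left)

section \<open>The closure of the graph and the intertwining unitary\<close>

abbreviation closed_graph :: "('a \<times> 'b) set"
  where "closed_graph \<equiv> closure graph"

lemma closed_graph_map:
  assumes "continuous_on UNIV S" "continuous_on UNIV T"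
    and "\<And>x y. (x, y) \<in> graph \<Longrightarrow> (S x, T y) \<in> graph"
    and "(x, y) \<in> closed_graph"
  shows "(S x, T y) \<in> closed_graph"
proof -
  have "continuous_on (closure graph) (\<lambda>p. (S (fst p), T (snd p)))"
    by (intro continuous_on_Pair continuous_on_compose2[OF assms(1)]
        continuous_on_compose2[OF assms(2)] continuous_intros) auto
  moreover have "(\<lambda>p. (S (fst p), T (snd p))) ` graph \<subseteq> closed_graph"
    using assms(3) closure_subset[of graph] by force
  ultimately have "(\<lambda>p. (S (fst p), T (snd p))) ` closure graph \<subseteq> closed_graph"
    by (intro image_closure_subset) auto
  then show ?thesis using assms(4) by force
qed

lemma closed_graph_add:
  assumes "(x, y) \<in> closed_graph" "(x', y') \<in> closed_graph"
  shows "(x + x', y + y') \<in> closed_graph"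
proof -
  obtain p q where p: "\<And>m. p m \<in> graph" "p \<longlonglongrightarrow> (x, y)" and q: "\<And>m. q m \<in> graph" "q \<longlonglongrightarrow> (x', y')"
    using assms unfolding closure_sequential by blast
  have "p m + q m \<in> graph" for m
    using intertwining_span.add[of "fst (p m)" "snd (p m)" k n V V' generators "fst (q m)" "snd (q m)"]
      p(1)[of m] q(1)[of m] by (simp add: plus_prod_def)
  moreover have "(\<lambda>m. p m + q m) \<longlonglongrightarrow> (x + x', y + y')"
    using tendsto_add[OF p(2) q(2)] by simp
  ultimately show ?thesis unfolding closure_sequential by (intro exI[of _ "\<lambda>m. p m + q m"]) simp
qed

lemma closed_graph_scale: "(x, y) \<in> closed_graph \<Longrightarrow> (c *\<^sub>C x, c *\<^sub>C y) \<in> closed_graph"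
  by (rule closed_graph_map)
    (auto intro: bounded_clinear_simps(6)[OF bounded_clinear_scaleC] intertwining_span.scale)

lemma closed_graph_op: "(x, y) \<in> closed_graph \<Longrightarrow> idx i s \<Longrightarrow> (V i s x, V' i s y) \<in> closed_graph"
  by (rule closed_graph_map[of "V i s" "V' i s"]) (auto intro: V.V_simps(6) V'.V_simps(6) graph_op)

lemma closed_graph_adj:
  "(x, y) \<in> closed_graph \<Longrightarrow> idx i s \<Longrightarrow> (V.adj i s x, V'.adj i s y) \<in> closed_graph"
  by (rule closed_graph_map[of "V.adj i s" "V'.adj i s"])
    (auto intro: V.adj_simps(6) V'.adj_simps(6) graph_adj)

lemma closed_graph_isometric:
  assumes "(x, y) \<in> closed_graph"
  shows "norm x = norm y"
proof -
  have "closed {p :: 'a \<times> 'b. norm (fst p) = norm (snd p)}"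
    by (intro closed_Collect_eq continuous_intros)
  moreover have "graph \<subseteq> {p. norm (fst p) = norm (snd p)}"
    using graph_isometric by (auto simp: norm_eq_sqrt_cinner)
  ultimately have "closed_graph \<subseteq> {p. norm (fst p) = norm (snd p)}"
    by (intro closure_minimal)
  then show ?thesis using assms by auto
qed

lemma closed_graph_dist:
  assumes "(x, y) \<in> closed_graph" "(x', y') \<in> closed_graph"
  shows "dist y y' = dist x x'"
  using closed_graph_isometric[OF closed_graph_add[OF assms(1) closed_graph_scale[OF assms(2), of "- 1"]]]
  by (simp add: scaleC_minus_one dist_norm)

lemma closed_graph_base:
  assumes "A \<subseteq> {1..k}" "x \<in> wandering A"
  shows "(x, \<phi> A x) \<in> closed_graph"
  using generator[OF assms] closure_subset by blast

lemma total_closed_graph: "fst ` closed_graph = UNIV" "snd ` closed_graph = UNIV"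
proof -
  have zero: "(0, 0) \<in> closed_graph" using zero_in_graph closure_subset by blast
  show "fst ` closed_graph = UNIV"
  proof (rule V.reducing_subspace_eq_UNIV)
    show "subspace (fst ` closed_graph)"
      by (rule subspaceI; unfold in_fst_image_iff scaleR_scaleC)
        (blast intro: zero closed_graph_add closed_graph_scale)+
    show "closed (fst ` closed_graph)"
      by (intro closed_fst_image_isometric closed_closure closed_graph_dist)
    show "V i s x \<in> fst ` closed_graph" if "idx i s" "x \<in> fst ` closed_graph" for i s x
      using that closed_graph_op unfolding in_fst_image_iff by blast
    show "V.adj i s x \<in> fst ` closed_graph" if "idx i s" "x \<in> fst ` closed_graph" for i s x
      using that closed_graph_adj unfolding in_fst_image_iff by blast
    show "wandering A \<subseteq> fst ` closed_graph" if "A \<subseteq> {1..k}" for A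
      unfolding subset_iff in_fst_image_iff using closed_graph_base[OF that] by blast
  qed
  show "snd ` closed_graph = UNIV"
  proof (rule V'.reducing_subspace_eq_UNIV)
    show "subspace (snd ` closed_graph)"
      by (rule subspaceI; unfold in_snd_image_iff scaleR_scaleC)
        (blast intro: zero closed_graph_add closed_graph_scale)+
    show "closed (snd ` closed_graph)"
      by (intro closed_snd_image_isometric closed_closure closed_graph_dist)
    show "V' i s x \<in> snd ` closed_graph" if "idx i s" "x \<in> snd ` closed_graph" for i s x
      using that closed_graph_op unfolding in_snd_image_iff by blast
    show "V'.adj i s x \<in> snd ` closed_graph" if "idx i s" "x \<in> snd ` closed_graph" for i s x
      using that closed_graph_adj unfolding in_snd_image_iff by blast
    show "wandering' A \<subseteq> snd ` closed_graph" if "A \<subseteq> {1..k}" for A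
      \<comment> \<open>Elements of \<open>wandering' A\<close> enter the second projection through
        their preimages under \<open>\<phi> A\<close>.\<close>
      unfolding phi_image[OF that, symmetric] image_subset_iff in_snd_image_iff
      using closed_graph_base[OF that] by blast
  qed
qed

lemma tuples_equivalent: "tuples_unitarily_equivalent k n V V'"
proof -
  obtain U where U: "unitary_between UNIV UNIV U" "\<And>x. (x, U x) \<in> closed_graph"
    using unitary_of_graph[of closed_graph] closed_graph_add closed_graph_scale
      closed_graph_isometric total_closed_graph by blast
  have "U (V i s x) = V' i s (U x)" if "idx i s" for i s x
    \<comment> \<open>Two pairs in the closed graph with the same first coordinate
      \<open>V i s x\<close> have second coordinates at distance zero.\<close>
    using closed_graph_dist[OF U(2)[of "V i s x"] closed_graph_op[OF U(2)[of x] that]] by simp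
  then show ?thesis
    using U(1) unfolding tuples_unitarily_equivalent_def V.idx_def by blast
qed

end

theorem theorem3p1:
  fixes k :: nat
    and n :: "nat \<Rightarrow> nat"
    and lam :: "nat \<Rightarrow> nat \<Rightarrow> nat \<Rightarrow> nat \<Rightarrow> complex"
    and V :: "nat \<Rightarrow> nat \<Rightarrow> 'a::complex_hilbert_space \<Rightarrow> 'a"
    and V' :: "nat \<Rightarrow> nat \<Rightarrow> 'b::complex_hilbert_space \<Rightarrow> 'b"
  assumes "k \<ge> 1"
    and "\<forall>i\<in>{1..k}. n i \<ge> 1"
    and "unimodular_system k n lam"
    and "doubly_commuting_row_isometries k n lam V"
    and "doubly_commuting_row_isometries k n lam V'"
  shows "tuples_unitarily_equivalent k n V V' \<longleftrightarrow>
    (\<forall>A \<subseteq> {1..k}. wandering_data_equivalent k n A (wandering_data k n V A) (wandering_data k n V' A))"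
proof -
  interpret doubly_commuting_pair k n lam V V'
    by (intro doubly_commuting_pair.intro doubly_commuting_rows.intro assms(3-5))
  show ?thesis
  proof
    assume "tuples_unitarily_equivalent k n V V'"
    then obtain U where U: "unitary_between UNIV UNIV U"
      and op: "\<And>i s x. i \<in> {1..k} \<Longrightarrow> s \<in> {1..n i} \<Longrightarrow> U (V i s x) = V' i s (U x)"
      unfolding tuples_unitarily_equivalent_def by blast
    show "\<forall>A \<subseteq> {1..k}.
      wandering_data_equivalent k n A (wandering_data k n V A) (wandering_data k n V' A)"
    proof (intro allI impI)
      fix A assume A: "A \<subseteq> {1..k}"
      have "U ` wandering A = wandering' A"
        using unitary_image_wandering[OF U A] op by (simp add: V.idx_def)
      then have "bij_betw U (wandering A) (wandering' A)"
        using bij_betw_subset[OF unitary_betweenD(4)[OF U]] by blast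
      then have "unitary_between (wandering A) (wandering' A) U"
        using U by (simp add: unitary_between_def)
      then show "wandering_data_equivalent k n A (wandering_data k n V A) (wandering_data k n V' A)"
        unfolding wandering_data_equivalent_iff[OF A] using op by blast
    qed
  next
    assume "\<forall>A \<subseteq> {1..k}.
      wandering_data_equivalent k n A (wandering_data k n V A) (wandering_data k n V' A)"
    \<comment> \<open>The condition on \<open>A\<close> moves inside the existential quantifier, so
      that a single choice function covers all \<open>A\<close>.\<close>
    then have "\<forall>A. \<exists>\<phi>. A \<subseteq> {1..k} \<longrightarrow> unitary_between (wandering A) (wandering' A) \<phi> \<and>
        (\<forall>j\<in>{1..k} - A. \<forall>t\<in>{1..n j}. \<forall>x\<in>wandering A. \<phi> (V j t x) = V' j t (\<phi> x))"
      using wandering_data_equivalent_iff by blast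
    then obtain \<phi> where \<phi>: "\<And>A. A \<subseteq> {1..k} \<Longrightarrow> unitary_between (wandering A) (wandering' A) (\<phi> A) \<and>
        (\<forall>j\<in>{1..k} - A. \<forall>t\<in>{1..n j}. \<forall>x\<in>wandering A. \<phi> A (V j t x) = V' j t (\<phi> A x))"
      by metis
    interpret equivalent_wandering_data k n lam V V' \<phi>
      using \<phi> by unfold_locales (auto simp: V.idx_def)
    show "tuples_unitarily_equivalent k n V V'" by (rule tuples_equivalent)
  qed
qed

end
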